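(* For all sufficiently large integers $n$, we have $c_\infty(P_n \,\Box\, P_n \,\Box\, P_n) > 0.7172\,n^2$.
   Context: The infinite-speed game of Cops and Robbers on a finite graph $G$: there is a team of cops and one robber, each occupying a vertex of $G$ (several cops may share a vertex), with all positions known to both players. The cops first choose their initial positions; then the robber chooses his initial position. The game proceeds in rounds, each consisting of a cop turn followed by a robber turn. On the cops' turn, each cop either stays at her vertex or moves to a neighboring vertex. On the robber's turn, he may stay put or move along any path in $G$ of arbitrary length starting at his current vertex that does not pass through any vertex occupied by a cop. The cops win if at some point some cop occupies the same vertex as the robber; the robber wins if he evades capture forever. The infinite-speed cop number $c_\infty(G)$ is the minimum number of cops that guarantees a win for the cops on $G$ no matter how the robber plays. $P_n$ denotes the path with $n$ vertices and $\Box$ denotes the Cartesian product of graphs. *)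

theory Defs
  imports Complex_Main "Graph_Theory.Pair_Digraph" "Graph_Theory.Vertex_Walk"
begin

text \<open>
  Finite simple graphs are the \<open>pair_graph\<close>s of the graph library: finite, loop-free digraphs
  without parallel arcs whose arc relation is symmetric.
\<close>

definition path_graph :: "nat \<Rightarrow> nat pair_pre_digraph" where
  "path_graph n = \<lparr>pverts = {0..<n},
     parcs = {(i, j). i < n \<and> j < n \<and> (j = Suc i \<or> i = Suc j)}\<rparr>"

definition cartesian_product ::
  "'a pair_pre_digraph \<Rightarrow> 'b pair_pre_digraph \<Rightarrow> ('a \<times> 'b) pair_pre_digraph"
  (infixr \<open>\<box>\<close> 70) where
  "G \<box> H = \<lparr>pverts = pverts G \<times> pverts H,
     parcs = {((u, v), (u', v')).
       u = u' \<and> u \<in> pverts G \<and> (v, v') \<in> parcs H \<or>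
       v = v' \<and> v \<in> pverts H \<and> (u, u') \<in> parcs G}\<rparr>"

lemma pair_graph_path_graph: "pair_graph (path_graph n)"
proof
  show "finite (parcs (path_graph n))"
    by (rule finite_subset[of _ "{0..<n} \<times> {0..<n}"]) (auto simp: path_graph_def)
  show "symmetric (with_proj (path_graph n))"
    by (auto simp: path_graph_def symmetric_def sym_def)
qed (auto simp: path_graph_def)

lemma pair_graph_cartesian_product:
  assumes "pair_graph G" and "pair_graph H"
  shows "pair_graph (G \<box> H)"
proof -
  interpret G: pair_graph G by fact
  interpret H: pair_graph H by fact
  have sub: "parcs (G \<box> H) \<subseteq> pverts (G \<box> H) \<times> pverts (G \<box> H)"
    by (auto simp: cartesian_product_def dest: G.wellformed' H.wellformed')
  have fin: "finite (pverts (G \<box> H))"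
    by (simp add: cartesian_product_def)
  show ?thesis
  proof
    show "fst e \<in> pverts (G \<box> H)" "snd e \<in> pverts (G \<box> H)" if "e \<in> parcs (G \<box> H)" for e
      using subsetD[OF sub that] by (simp_all add: mem_Times_iff)
    show "finite (pverts (G \<box> H))"
      by (rule fin)
    show "finite (parcs (G \<box> H))"
      by (rule finite_subset[OF sub finite_cartesian_product[OF fin fin]])
    show "fst e \<noteq> snd e" if "e \<in> parcs (G \<box> H)" for e
      using that G.pair_no_loops H.pair_no_loops by (fastforce simp: cartesian_product_def)
    have "sym (parcs G)" "sym (parcs H)"
      using G.pair_sym_arcs H.pair_sym_arcs by (simp_all add: symmetric_def)
    then have "sym (parcs (G \<box> H))"
      unfolding sym_def cartesian_product_def by fastforce
    then show "symmetric (with_proj (G \<box> H))"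
      by (simp add: symmetric_def)
  qed
qed

text \<open>
  A strategy of the cops maps the list \<open>[r\<^sub>0, \<dots>, r\<^sub>t]\<close> of all positions the robber has
  taken so far to the list of the cops' positions after their next turn, the \<open>i\<close>-th entry being
  the position of the \<open>i\<close>-th cop; \<open>\<sigma> []\<close> is their initial placement. The cops' own earlier
  positions are determined by \<open>\<sigma>\<close> and so need not be arguments. Demanding legal moves also on
  histories that cannot occur in a game is no restriction, since the cops may always stay.
\<close>

definition cop_strategy :: "'a pair_pre_digraph \<Rightarrow> nat \<Rightarrow> ('a list \<Rightarrow> 'a list) \<Rightarrow> bool" where
  "cop_strategy G k \<sigma> \<longleftrightarrow>
     (\<forall>h \<in> lists (pverts G). length (\<sigma> h) = k \<and> set (\<sigma> h) \<subseteq> pverts G) \<and>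
     (\<forall>h \<in> lists (pverts G). \<forall>x \<in> pverts G. \<forall>i < k.
        \<sigma> (h @ [x]) ! i = \<sigma> h ! i \<or> (\<sigma> h ! i, \<sigma> (h @ [x]) ! i) \<in> parcs G)"

definition robber_move :: "'a pair_pre_digraph \<Rightarrow> 'a set \<Rightarrow> 'a \<Rightarrow> 'a \<Rightarrow> bool" where
  "robber_move G C u v \<longleftrightarrow>
     v = u \<or> (\<exists>p. vpath p (with_proj G) \<and> hd p = u \<and> last p = v \<and> set p \<inter> C = {})"

text \<open>
  For a robber playing \<open>r\<^sub>0, r\<^sub>1, \<dots>\<close> against \<open>\<sigma>\<close>, this is the cops' placement \<open>C\<^sub>t\<close> after
  \<open>t\<close> cop turns, so the positions occur in the order \<open>C\<^sub>0, r\<^sub>0, C\<^sub>1, r\<^sub>1, C\<^sub>2, \<dots>\<close>.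
\<close>

definition cops_at :: "('a list \<Rightarrow> 'a list) \<Rightarrow> (nat \<Rightarrow> 'a) \<Rightarrow> nat \<Rightarrow> 'a list" where
  "cops_at \<sigma> r t = \<sigma> (map r [0..<t])"

definition robber_play ::
  "'a pair_pre_digraph \<Rightarrow> ('a list \<Rightarrow> 'a list) \<Rightarrow> (nat \<Rightarrow> 'a) \<Rightarrow> bool" where
  "robber_play G \<sigma> r \<longleftrightarrow>
     r 0 \<in> pverts G \<and> (\<forall>t. robber_move G (set (cops_at \<sigma> r (Suc t))) (r t) (r (Suc t)))"

text \<open>
  The robber can be caught after one of his own turns or after a cop turn. A play is formally
  continued after a capture (the robber may stay put), which does not affect who wins.
\<close>

definition captured :: "('a list \<Rightarrow> 'a list) \<Rightarrow> (nat \<Rightarrow> 'a) \<Rightarrow> bool" where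
  "captured \<sigma> r \<longleftrightarrow>
     (\<exists>t. r t \<in> set (cops_at \<sigma> r t) \<or> r t \<in> set (cops_at \<sigma> r (Suc t)))"

definition cops_win :: "'a pair_pre_digraph \<Rightarrow> nat \<Rightarrow> bool" where
  "cops_win G k \<longleftrightarrow>
     (\<exists>\<sigma>. cop_strategy G k \<sigma> \<and> (\<forall>r. robber_play G \<sigma> r \<longrightarrow> captured \<sigma> r))"

definition c_inf :: "'a pair_pre_digraph \<Rightarrow> nat" where
  "c_inf G = (LEAST k. cops_win G k)"

text \<open>The minimum is attained on finite graphs: a cop on every vertex wins at once.\<close>

lemma cops_win_card:
  assumes "finite (pverts G)"
  shows "cops_win G (card (pverts G))"
proof -
  obtain C where C: "set C = pverts G" "distinct C"
    using finite_distinct_list[OF assms] by blast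
  then have "length C = card (pverts G)"
    by (metis distinct_card)
  then have "cop_strategy G (card (pverts G)) (\<lambda>_. C)"
    using C by (simp add: cop_strategy_def)
  moreover have "captured (\<lambda>_. C) r" if "robber_play G (\<lambda>_. C) r" for r
    using that C by (auto simp: robber_play_def captured_def cops_at_def)
  ultimately show ?thesis
    unfolding cops_win_def by blast
qed

lemma cops_win_c_inf: "finite (pverts G) \<Longrightarrow> cops_win G (c_inf G)"
  unfolding c_inf_def by (rule LeastI) (rule cops_win_card)

end

theory Submission
  imports Defs
begin

text \<open>
  The layers of the grid are the sets of vertices with a given first coordinate. Call a set of
  vertices cut off if it is a union of components of the graph without the cops. The proof measures
  a cut-off set by the areas of its layers, for which there are two constraints. In a layer with
  \<open>p < n\<close> cops, either the set or the rest of the layer has area at most about \<open>p\<^sup>2 / 2\<close>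
  (\<open>cut_off_dichotomy\<close>); and the areas in adjacent layers differ by at most the number of
  cops in one of the two, because the vertical edges have to be blocked (\<open>card_slice_step\<close>).
  So if a cut-off set fills almost all of one layer with at most \<open>\<mu>\<close> cops and almost nothing of
  another, then its area passes through all intermediate values in between, and these layers hold
  about \<open>(n - \<mu>)\<^sup>2\<close> cops in excess of \<open>\<mu>\<close> cops each (\<open>crossing_cost\<close>). If moreover every
  block of a fixed number of consecutive layers has about \<open>\<mu>\<close> cops per layer, the total is at
  least about \<open>\<mu> n + (n - \<mu>)\<^sup>2 \<ge> 3 n\<^sup>2 / 4\<close> (\<open>two_thin_slices_cost\<close>). With at most
  \<open>0.7172 n\<^sup>2\<close> cops this cannot happen: the large parts of all layers that have
  about as few cops as possible belong to one and the same region, marked by an \<open>anchor\<close>.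

  The robber has to choose his vertex before he sees the next move of the cops. Let \<open>w\<close> be a large
  constant. Among the slabs of \<open>w\<close> consecutive layers he takes one with the fewest cops, and in
  it a tube of cross-section \<open>w \<times> w\<close> with fewer than \<open>(w - 2)\<^sup>2\<close> cops. Since a cop can reach
  the inner lines of the tube only from within the tube, some inner line is free after any cop
  turn; it links all cross-sections that had no cop close by (\<open>core_connected\<close>). Such a
  cross-section meets a row in every inner layer of the slab, so a robber standing in one of them
  reaches nearly all free rows of these layers (\<open>core_area\<close>). One of these layers has at most
  about \<open>\<mu> \<le> 0.72 n\<close> cops, and there his region has area at least about
  \<open>n (n - \<mu>) > \<mu>\<^sup>2 / 2\<close>, so it is the large part of that layer. Hence he is linked to the
  anchor of the new cop placement (\<open>anchor_in_core\<close>), and as the vertex that he would choose next is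
  linked to this anchor too, he can go there and continue forever.
\<close>

section \<open>A potential for areas of layers\<close>

text \<open>
  If an area \<open>t \<le> n\<^sup>2 / 2\<close> is written as \<open>u\<^sup>2 / 2\<close>, a layer whose cut-off part has this area
  needs about \<open>u\<close> cops. Raising the area so slowly that each layer adds 1 to \<open>u\<close> costs
  the sum of the excesses \<open>u - M\<close> over \<open>M\<close> cops per layer, which is this function. Faster
  changes are no cheaper, since a change of the area by \<open>d\<close> needs \<open>d\<close> cops.
\<close>

definition excess :: "real \<Rightarrow> real \<Rightarrow> real" where
  "excess M t = (max 0 (sqrt (2 * t) - M))\<^sup>2 / 2"

text \<open>
  Above half of the layer, the area of the complement takes the role of the area.
\<close>

definition potential :: "real \<Rightarrow> real \<Rightarrow> real \<Rightarrow> real" where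
  "potential n M a = excess M (min a (n\<^sup>2 / 2)) - excess M (min (n\<^sup>2 - a) (n\<^sup>2 / 2))"

text \<open>
  At \<open>t = u\<^sup>2 / 2\<close> with \<open>u > M\<close> the derivative of the excess is \<open>1 - M / u\<close>, which
  increases with \<open>u\<close>.
\<close>

lemma excess_diff_le:
  assumes "0 \<le> t" "t \<le> s" "sqrt (2 * s) \<le> g" "0 \<le> M" "M \<le> g" "0 < g"
  shows "excess M s - excess M t \<le> (s - t) * (1 - M / g)"
proof (cases "sqrt (2 * s) \<le> M")
  case True
  then have "excess M s = 0" by (simp add: excess_def max_def)
  moreover have "excess M t \<ge> 0" by (simp add: excess_def)
  moreover have "(s - t) * (1 - M / g) \<ge> 0" using assms by (intro mult_nonneg_nonneg) (auto simp: field_simps)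
  ultimately show ?thesis by linarith
next
  case False
  define u where "u = sqrt (2 * s)"
  define v where "v = max (sqrt (2 * t)) M"
  have uM: "u > M" using False by (simp add: u_def)
  have u0: "u > 0" using uM assms by linarith
  have tu: "sqrt (2 * t) \<le> u" unfolding u_def using assms by simp
  have vu: "v \<le> u" using tu uM by (simp add: v_def)
  have vM: "v \<ge> M" by (simp add: v_def)
  have P: "excess M s - excess M t = ((u - M)\<^sup>2 - (v - M)\<^sup>2) / 2"
    using uM by (simp add: excess_def u_def[symmetric] v_def max_def diff_divide_distrib)
  have fac: "0 \<le> 1 - M / g" using assms by (simp add: field_simps)
  have s2: "2 * s = u\<^sup>2" using assms by (simp add: u_def)
  have "sqrt (2 * t) \<le> v" by (simp add: v_def)
  then have "(sqrt (2 * t))\<^sup>2 \<le> v\<^sup>2" using assms by (intro power_mono) auto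
  then have t2: "2 * t \<le> v\<^sup>2" using assms by simp
  have "M / g \<le> M / u"
    using assms u0 by (intro divide_left_mono) (auto simp: u_def)
  then have mg: "1 - M / u \<le> 1 - M / g" by simp
  have "(u + v) * M \<le> 2 * u * M" using vu assms by (intro mult_right_mono) auto
  then have k: "u + v - 2 * M \<le> (u + v) * (1 - M / u)" using u0 by (simp add: field_simps)
  have "excess M s - excess M t = (u - v) * (u + v - 2 * M) / 2"
    unfolding P by (simp add: power2_eq_square algebra_simps)
  also have "\<dots> \<le> (u - v) * ((u + v) * (1 - M / u)) / 2"
    using k vu by (intro divide_right_mono mult_left_mono) auto
  also have "\<dots> = (u\<^sup>2 - v\<^sup>2) / 2 * (1 - M / u)"
    using u0 by (simp add: power2_eq_square field_simps)
  also have "\<dots> \<le> (u\<^sup>2 - v\<^sup>2) / 2 * (1 - M / g)"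
    using vu vM assms mg by (intro mult_left_mono) (auto intro!: power_mono)
  also have "\<dots> \<le> (s - t) * (1 - M / g)"
    using s2 t2 fac assms by (intro mult_right_mono) auto
  finally show ?thesis .
qed

lemma excess_mono:
  assumes "s \<le> t"
  shows "excess M s \<le> excess M t"
proof -
  have "sqrt (2 * s) \<le> sqrt (2 * t)" using assms by simp
  then show ?thesis unfolding excess_def by (intro divide_right_mono power_mono max.mono) auto
qed

lemma potential_mono: "a \<le> a' \<Longrightarrow> potential n M a \<le> potential n M a'"
  unfolding potential_def by (intro diff_mono excess_mono min.mono) auto

lemma potential_diff_le:
  assumes "0 \<le> a'" "a' \<le> a" "a \<le> n\<^sup>2" "0 \<le> M" "M \<le> g" "0 < g"
    and "sqrt (2 * min a (n\<^sup>2 / 2)) \<le> g \<or> n\<^sup>2 / 2 \<le> a'"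
    and "sqrt (2 * min (n\<^sup>2 - a') (n\<^sup>2 / 2)) \<le> g \<or> a \<le> n\<^sup>2 / 2"
  shows "potential n M a - potential n M a' \<le> (a - a') * (1 - M / g)"
proof -
  let ?h = "n\<^sup>2 / 2"
  have 1: "excess M (min a ?h) - excess M (min a' ?h) \<le> (min a ?h - min a' ?h) * (1 - M / g)"
  proof (cases "?h \<le> a'")
    case True
    then have e: "min a ?h = ?h" "min a' ?h = ?h" using assms by (auto simp: min_def)
    show ?thesis unfolding e by simp
  next
    case False then show ?thesis using assms by (intro excess_diff_le) auto
  qed
  have 2: "excess M (min (n\<^sup>2 - a') ?h) - excess M (min (n\<^sup>2 - a) ?h)
      \<le> (min (n\<^sup>2 - a') ?h - min (n\<^sup>2 - a) ?h) * (1 - M / g)"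
  proof (cases "a \<le> ?h")
    case True
    then have e: "min (n\<^sup>2 - a) ?h = ?h" "min (n\<^sup>2 - a') ?h = ?h" using assms by (auto simp: min_def)
    show ?thesis unfolding e by simp
  next
    case False then show ?thesis using assms by (intro excess_diff_le) auto
  qed
  have "(min a ?h - min a' ?h) + (min (n\<^sup>2 - a') ?h - min (n\<^sup>2 - a) ?h) = a - a'"
    by (auto simp: min_def field_simps)
  then have "(min a ?h - min a' ?h) * (1 - M / g) + (min (n\<^sup>2 - a') ?h - min (n\<^sup>2 - a) ?h) * (1 - M / g)
     = (a - a') * (1 - M / g)" by (metis distrib_right)
  then show ?thesis using 1 2 unfolding potential_def by linarith
qed

text \<open>
  One step from a layer to the next one with \<open>p\<close> cops: \<open>a\<close> and \<open>a'\<close> are the two areas, and the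
  last assumption is the isoperimetric inequality in the new layer. The potential has slope at most
  \<open>1 - M / (p + 1)\<close> on the range in question, and \<open>p\<close> times this slope is at most \<open>p - M + 1\<close>.
\<close>

lemma potential_step:
  assumes a: "0 \<le> a'" "a \<le> n\<^sup>2" "a - a' \<le> p" and M: "0 \<le> M" "M \<le> p" "M \<le> n" and n: "0 < n"
    and iso: "n \<le> p \<or> 2 * a' \<le> p\<^sup>2 \<or> 2 * (n\<^sup>2 - a') \<le> p\<^sup>2 + p"
  shows "potential n M a - potential n M a' \<le> p - M + 1"
proof (cases "a \<le> a'")
  case True
  then show ?thesis using potential_mono[OF True, of n M] M by linarith
next
  case False
  have p0: "p \<ge> 0" using M by linarith
  \<comment> \<open>At half of the layer, where the slope is largest, it is \<open>1 - M / n\<close>.\<close>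
  have main: "potential n M a - potential n M a' \<le> p - M + 1" if "n \<le> p + 1"
  proof -
    have "sqrt (2 * min a (n\<^sup>2 / 2)) \<le> n" "sqrt (2 * min (n\<^sup>2 - a') (n\<^sup>2 / 2)) \<le> n"
      using n min.cobounded2[of a "n\<^sup>2 / 2"] min.cobounded2[of "n\<^sup>2 - a'" "n\<^sup>2 / 2"]
      by (auto intro!: real_le_lsqrt)
    then have "potential n M a - potential n M a' \<le> (a - a') * (1 - M / n)"
      using a M n False by (intro potential_diff_le) auto
    also have "\<dots> \<le> p * (1 - M / n)"
      using a M n by (intro mult_right_mono) (auto simp: field_simps)
    also have "\<dots> \<le> p - M + 1"
    proof -
      have "M * n \<le> M * p + n"
        using mult_left_mono[OF that M(1)] M(3) by (simp add: algebra_simps)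
      then show ?thesis using n by (simp add: field_simps)
    qed
    finally show ?thesis .
  qed
  show ?thesis
  proof (cases "n \<le> p + 1")
    case True then show ?thesis by (rule main)
  next
    case small: False
    have iso': "2 * a' \<le> p\<^sup>2 \<or> 2 * (n\<^sup>2 - a') \<le> p\<^sup>2 + p" using iso small by linarith
    have sq: "(p + 1)\<^sup>2 < n\<^sup>2" using small p0 by (intro power_strict_mono) auto
    have e: "(p + 1)\<^sup>2 = p\<^sup>2 + 2 * p + 1" by (simp add: power2_eq_square algebra_simps)
    have r: "sqrt x \<le> p + 1" if "x \<le> (p + 1)\<^sup>2" for x
      using real_sqrt_le_mono[OF that] p0 by simp
    have "potential n M a - potential n M a' \<le> (a - a') * (1 - M / (p + 1))"
    proof (intro potential_diff_le)
      show "sqrt (2 * min a (n\<^sup>2 / 2)) \<le> p + 1 \<or> n\<^sup>2 / 2 \<le> a'"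
        using iso' sq e a p0 by (auto intro!: r)
      show "sqrt (2 * min (n\<^sup>2 - a') (n\<^sup>2 / 2)) \<le> p + 1 \<or> a \<le> n\<^sup>2 / 2"
        using iso' sq e a p0 by (auto intro!: r)
    qed (use a M False p0 in auto)
    also have "\<dots> \<le> p * (1 - M / (p + 1))"
      using a M p0 by (intro mult_right_mono) (auto simp: field_simps)
    also have "\<dots> \<le> p - M + 1"
      using M p0 by (simp add: field_simps)
    finally show ?thesis .
  qed
qed

lemma excess_le_half:
  assumes "2 * t \<le> (M + 1)\<^sup>2" "0 \<le> M"
  shows "excess M t \<le> 1 / 2"
proof -
  have "sqrt (2 * t) \<le> M + 1" using real_sqrt_le_mono[OF assms(1)] assms(2) by simp
  then have "max 0 (sqrt (2 * t) - M) \<le> 1" by simp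
  then have "(max 0 (sqrt (2 * t) - M))\<^sup>2 \<le> 1\<^sup>2" by (intro power_mono) auto
  then show ?thesis by (simp add: excess_def)
qed

lemma excess_top: "0 \<le> M \<Longrightarrow> M \<le> n \<Longrightarrow> excess M (n\<^sup>2 / 2) = (n - M)\<^sup>2 / 2"
  by (simp add: excess_def max_def)

lemma potential_start:
  assumes "2 * (n\<^sup>2 - a) \<le> (M + 1)\<^sup>2" "0 \<le> M" "M + 1 \<le> n"
  shows "potential n M a \<ge> (n - M)\<^sup>2 / 2 - 1 / 2"
proof -
  have "(M + 1)\<^sup>2 \<le> n\<^sup>2" using assms by (intro power_mono) auto
  then have "min a (n\<^sup>2 / 2) = n\<^sup>2 / 2" "min (n\<^sup>2 - a) (n\<^sup>2 / 2) = n\<^sup>2 - a" using assms(1) by (simp_all add: min_def)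
  then show ?thesis unfolding potential_def using excess_le_half[OF assms(1,2)] excess_top[of M n] assms by simp
qed

lemma potential_end:
  assumes "2 * a \<le> (M + 1)\<^sup>2" "0 \<le> M" "M + 1 \<le> n"
  shows "potential n M a \<le> 1 / 2 - (n - M)\<^sup>2 / 2"
proof -
  have "(M + 1)\<^sup>2 \<le> n\<^sup>2" using assms by (intro power_mono) auto
  then have "min (n\<^sup>2 - a) (n\<^sup>2 / 2) = n\<^sup>2 / 2" "min a (n\<^sup>2 / 2) = a" using assms(1) by (simp_all add: min_def)
  then show ?thesis unfolding potential_def using excess_le_half[OF assms(1,2)] excess_top[of M n] assms by simp
qed

section \<open>The isoperimetric inequality of the square, row by row\<close>

lemma le_add_sum_up:
  fixes y p :: "nat \<Rightarrow> nat"
  assumes "a \<le> b" "\<And>i. a \<le> i \<Longrightarrow> i < b \<Longrightarrow> y i \<le> y (Suc i) + p (Suc i)"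
  shows "y a \<le> y b + (\<Sum>i\<in>{a<..b}. p i)"
  using assms
proof (induction b rule: dec_induct)
  case base then show ?case by simp
next
  case (step k)
  have "{a<..Suc k} = insert (Suc k) {a<..k}" using step.hyps by auto
  moreover have "y k \<le> y (Suc k) + p (Suc k)" using step.prems[of k] step.hyps by simp
  moreover have "y a \<le> y k + (\<Sum>i\<in>{a<..k}. p i)" by (rule step.IH) (use step.prems in auto)
  ultimately show ?case by simp
qed

lemma le_add_sum_down:
  fixes y p :: "nat \<Rightarrow> nat"
  assumes "a \<le> b" "\<And>i. a \<le> i \<Longrightarrow> i < b \<Longrightarrow> y (Suc i) \<le> y i + p i"
  shows "y b \<le> y a + (\<Sum>i\<in>{a..<b}. p i)"
  using assms
proof (induction b rule: dec_induct)
  case base then show ?case by simp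
next
  case (step k)
  have "y (Suc k) \<le> y k + p k" using step.prems[of k] step.hyps by simp
  moreover have "y k \<le> y a + (\<Sum>i\<in>{a..<k}. p i)" by (rule step.IH) (use step.prems in auto)
  ultimately show ?case using step.hyps by simp
qed

text \<open>
  The isoperimetric inequality of the square in terms of rows: \<open>y i\<close> and \<open>p i\<close> count the
  vertices of a cut-off set and the cops in row \<open>i\<close>. Some row has no cop, so \<open>y\<close> vanishes there. The
  rows with \<open>y i \<ge> v\<close> contain at least one cop each, and on the way from them to the empty row
  \<open>y\<close> has to fall from \<open>v\<close> to 0, at a cost of \<open>v\<close> further cops. So at most \<open>q - v\<close> rows have
  \<open>y i \<ge> v\<close>, and these bounds are summed over \<open>v\<close>.
\<close>

lemma triangular_bound:
  fixes y p :: "nat \<Rightarrow> nat"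
  assumes up: "\<And>i. Suc i < n \<Longrightarrow> y (Suc i) \<le> y i + p i"
    and down: "\<And>i. Suc i < n \<Longrightarrow> y i \<le> y (Suc i) + p (Suc i)"
    and pos: "\<And>i. i < n \<Longrightarrow> 0 < y i \<Longrightarrow> 0 < p i"
    and q: "(\<Sum>i<n. p i) = q" "q < n"
  shows "2 * (\<Sum>i<n. y i) \<le> q * (q - 1)"
proof -
  obtain i0 where i0: "i0 < n" "y i0 = 0"
  proof -
    have "\<exists>i<n. p i = 0"
    proof (rule ccontr)
      assume "\<not> ?thesis"
      then have "\<And>i. i < n \<Longrightarrow> 1 \<le> p i" by force
      then have "(\<Sum>i<n. 1) \<le> (\<Sum>i<n. p i)" by (intro sum_mono) auto
      then show False using q by simp
    qed
    then show ?thesis using that pos by (metis less_irrefl neq0_conv)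
  qed
  define R where "R v = {i. i < n \<and> v \<le> y i}" for v
  have finR: "finite (R v)" for v by (simp add: R_def)
  have card_R: "card (R v) + v \<le> q" if v: "v \<ge> 1" and ne: "R v \<noteq> {}" for v
  proof -
    have i0R: "i0 \<notin> R v" using i0 v by (simp add: R_def)
    have "card (R v) = (\<Sum>i\<in>R v. 1)" by simp
    also have "\<dots> \<le> (\<Sum>i\<in>R v. p i)"
    proof (rule sum_mono)
      fix i assume "i \<in> R v"
      then have "i < n" "0 < y i" using v by (auto simp: R_def)
      then show "1 \<le> p i" using pos[of i] by simp
    qed
    finally have c: "card (R v) \<le> (\<Sum>i\<in>R v. p i)" .
    \<comment> \<open>\<open>I\<close> runs from the row of \<open>R v\<close> next to \<open>i0\<close>, on either side, up to \<open>i0\<close>.\<close>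
    have fin: "\<exists>I \<subseteq> {..<n} - R v. v \<le> (\<Sum>i\<in>I. p i)"
    proof (cases "\<exists>j\<in>R v. j < i0")
      case True
      define j where "j = Max {j\<in>R v. j < i0}"
      have ne': "{j\<in>R v. j < i0} \<noteq> {}" using True by blast
      have "j \<in> {j\<in>R v. j < i0}" unfolding j_def using finR ne' by (intro Max_in) auto
      then have j: "j \<in> R v" "j < i0" by auto
      have "y j \<le> y i0 + (\<Sum>i\<in>{j<..i0}. p i)"
        using j i0 by (intro le_add_sum_up down) auto
      moreover have "k \<notin> R v" if "k \<in> {j<..i0}" for k
      proof
        assume "k \<in> R v"
        moreover from this have "k \<noteq> i0" using i0R by blast
        ultimately have "k \<le> j" unfolding j_def using that finR by (intro Max_ge) auto
        then show False using that by simp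
      qed
      ultimately show ?thesis using j i0 by (intro exI[of _ "{j<..i0}"]) (auto simp: R_def)
    next
      case False
      define j where "j = Min (R v)"
      have "j \<in> R v" unfolding j_def using finR ne by (intro Min_in) auto
      then have j: "j \<in> R v" "i0 < j" using False i0R by (metis linorder_neqE_nat)+
      have "y j \<le> y i0 + (\<Sum>i\<in>{i0..<j}. p i)"
        using j by (intro le_add_sum_down up) (auto simp: R_def)
      moreover have "k \<notin> R v" if "k \<in> {i0..<j}" for k
      proof
        assume "k \<in> R v"
        then have "j \<le> k" unfolding j_def using finR by (intro Min_le) auto
        then show False using that by simp
      qed
      ultimately show ?thesis using j i0 by (intro exI[of _ "{i0..<j}"]) (auto simp: R_def)
    qed
    then obtain I where I: "I \<subseteq> {..<n} - R v" "v \<le> (\<Sum>i\<in>I. p i)" by blast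
    have "(\<Sum>i\<in>R v. p i) + (\<Sum>i\<in>I. p i) = (\<Sum>i\<in>R v \<union> I. p i)"
      using I finR by (intro sum.union_disjoint[symmetric]) (auto intro: finite_subset)
    also have "\<dots> \<le> (\<Sum>i<n. p i)"
      using I by (intro sum_mono2) (auto simp: R_def)
    finally show ?thesis using c I q by simp
  qed
  have yle: "y i \<le> q" if "i < n" for i
  proof (cases "y i = 0")
    case False
    then have "i \<in> R (y i)" using that by (simp add: R_def)
    then have "card (R (y i)) + y i \<le> q" using False by (intro card_R) auto
    then show ?thesis by simp
  qed simp
  have "(\<Sum>i<n. y i) = (\<Sum>i<n. \<Sum>v\<in>{1..q}. if v \<le> y i then 1 else 0)"
  proof (intro sum.cong refl)
    fix i assume "i \<in> {..<n}"
    then have "{1..q} \<inter> {v. v \<le> y i} = {1..y i}" using yle[of i] by auto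
    then show "y i = (\<Sum>v\<in>{1..q}. if v \<le> y i then 1 else 0)"
      by (simp add: sum.If_cases)
  qed
  also have "\<dots> = (\<Sum>v\<in>{1..q}. \<Sum>i<n. if v \<le> y i then 1 else 0)" by (rule sum.swap)
  also have "\<dots> = (\<Sum>v\<in>{1..q}. card (R v))"
  proof (intro sum.cong refl)
    fix v
    have "{..<n} \<inter> {i. v \<le> y i} = R v" by (auto simp: R_def)
    then show "(\<Sum>i<n. if v \<le> y i then 1 else 0) = card (R v)" by (simp add: sum.If_cases)
  qed
  also have "\<dots> \<le> (\<Sum>v\<in>{1..q}. q - v)"
  proof (rule sum_mono)
    fix v assume "v \<in> {1..q}"
    then show "card (R v) \<le> q - v" using card_R[of v] by (cases "R v = {}") auto
  qed
  also have "\<dots> = (\<Sum>v<q. v)"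
    by (rule sum.reindex_bij_witness[of _ "\<lambda>v. q - v" "\<lambda>v. q - v"]) auto
  finally have *: "(\<Sum>i<n. y i) \<le> (\<Sum>v<q. v)" .
  have "2 * (\<Sum>v<q. v) = q * (q - 1)" by (induction q) (simp_all add: algebra_simps diff_mult_distrib2)
  then show ?thesis using * by linarith
qed

section \<open>Cut-off sets in the square and in the cube\<close>

text \<open>
  The unions of components of the graph \<open>(V, E)\<close> without the vertices in \<open>S\<close>. Components
  themselves are used only for the robber; all estimates hold for such unions, which has
  the advantage that they are closed under complement.
\<close>

definition cut_off :: "('a \<Rightarrow> 'a \<Rightarrow> bool) \<Rightarrow> 'a set \<Rightarrow> 'a set \<Rightarrow> 'a set \<Rightarrow> bool" where
  "cut_off E V S X \<longleftrightarrow> X \<subseteq> V - S \<and> (\<forall>u\<in>X. \<forall>v\<in>V - S. E u v \<longrightarrow> v \<in> X)"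

lemma cut_offD: "cut_off E V S X \<Longrightarrow> u \<in> X \<Longrightarrow> E u v \<Longrightarrow> v \<in> V \<Longrightarrow> v \<notin> S \<Longrightarrow> v \<in> X"
  by (auto simp: cut_off_def)

lemma cut_off_subset: "cut_off E V S X \<Longrightarrow> X \<subseteq> V - S"
  by (simp add: cut_off_def)

lemma cut_off_complement:
  assumes "symp E" "cut_off E V S X"
  shows "cut_off E V S (V - S - X)"
  using assms unfolding cut_off_def symp_def by blast

lemma cut_off_line:
  fixes f :: "nat \<Rightarrow> 'a"
  assumes "symp E" "cut_off E V S X"
    and "\<And>t. min a b \<le> t \<Longrightarrow> t \<le> max a b \<Longrightarrow> f t \<in> V - S"
    and "\<And>t. E (f t) (f (Suc t))"
    and "f a \<in> X"
  shows "f b \<in> X"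
proof (cases "a \<le> b")
  case True
  have "t \<le> b \<longrightarrow> f t \<in> X" if "a \<le> t" for t
    using that
  proof (induction t rule: dec_induct)
    case base then show ?case using assms by simp
  next
    case (step k)
    show ?case
    proof
      assume "Suc k \<le> b"
      moreover from this have "f (Suc k) \<in> V - S" using assms(3)[of "Suc k"] step.hyps True by simp
      ultimately show "f (Suc k) \<in> X"
        using cut_offD[OF assms(2), of "f k" "f (Suc k)"] assms(4) step.IH by simp
    qed
  qed
  then show ?thesis using True by simp
next
  case False
  then have le: "b \<le> a" by simp
  have "b \<le> b \<longrightarrow> f b \<in> X"
    using le
  proof (induction b rule: inc_induct)
    case base then show ?case using assms by simp
  next
    case (step k)
    have "f k \<in> V - S" using assms(3)[of k] step False by simp
    moreover have "E (f (Suc k)) (f k)" using assms(1,4) by (meson sympD)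
    ultimately show ?case using cut_offD[OF assms(2), of "f (Suc k)" "f k"] step by simp
  qed
  then show ?thesis by simp
qed

definition near :: "nat \<Rightarrow> nat \<Rightarrow> bool" where
  "near a b \<longleftrightarrow> b = Suc a \<or> a = Suc b"

definition adj2 :: "nat \<times> nat \<Rightarrow> nat \<times> nat \<Rightarrow> bool" where
  "adj2 u v \<longleftrightarrow> fst u = fst v \<and> near (snd u) (snd v) \<or> snd u = snd v \<and> near (fst u) (fst v)"

definition adj3 :: "nat \<times> nat \<times> nat \<Rightarrow> nat \<times> nat \<times> nat \<Rightarrow> bool" where
  "adj3 u v \<longleftrightarrow> fst u = fst v \<and> adj2 (snd u) (snd v) \<or> snd u = snd v \<and> near (fst u) (fst v)"

definition square :: "nat \<Rightarrow> (nat \<times> nat) set" where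
  "square n = {..<n} \<times> {..<n}"

definition cube :: "nat \<Rightarrow> (nat \<times> nat \<times> nat) set" where
  "cube n = {..<n} \<times> square n"

lemma symp_adj: "symp adj2" "symp adj3"
  by (auto intro!: sympI simp: adj2_def adj3_def near_def)

lemma adj_Suc [simp]:
  "adj2 (t, j) (Suc t, j)" "adj2 (i, t) (i, Suc t)"
  "adj3 (t, u) (Suc t, u)" "adj3 (h, t, j) (h, Suc t, j)" "adj3 (h, i, t) (h, i, Suc t)"
  by (simp_all add: adj2_def adj3_def near_def)

lemma finite_square [simp]: "finite (square n)" and card_square [simp]: "card (square n) = n\<^sup>2"
  by (simp_all add: square_def power2_eq_square)

lemma finite_cube [simp]: "finite (cube n)"
  by (simp add: cube_def)

lemma in_square [simp]: "(i, j) \<in> square n \<longleftrightarrow> i < n \<and> j < n"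
  by (simp add: square_def)

lemma in_cube [simp]: "(h, u) \<in> cube n \<longleftrightarrow> h < n \<and> u \<in> square n"
  by (simp add: cube_def)

lemma card_eq_sum_rows:
  assumes "Y \<subseteq> square n"
  shows "card Y = (\<Sum>i<n. card {j. (i, j) \<in> Y})"
proof -
  have eq: "Y = (SIGMA i:{..<n}. {j. (i, j) \<in> Y})" using assms by (auto simp: square_def)
  have fin: "finite {j. (i, j) \<in> Y}" for i
    by (rule finite_subset[of _ "{..<n}"]) (use assms in \<open>auto simp: square_def\<close>)
  have "card (SIGMA i:{..<n}. {j. (i, j) \<in> Y}) = (\<Sum>i<n. card {j. (i, j) \<in> Y})"
    by (rule card_SigmaI) (use fin in auto)
  with arg_cong[OF eq, of card] show ?thesis by (rule trans)
qed

lemma cut_off_square_bound: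
  assumes Y: "cut_off adj2 (square n) P Y" and P: "P \<subseteq> square n" "card P \<le> q" "q < n"
    and rows: "\<And>i j. (i, j) \<in> Y \<Longrightarrow> \<exists>j'. (i, j') \<in> P"
  shows "2 * card Y \<le> q * (q - 1)"
proof -
  have Ysub: "Y \<subseteq> square n" using cut_off_subset[OF Y] by blast
  define y where "y i = card {j. (i, j) \<in> Y}" for i
  define p where "p i = card {j. (i, j) \<in> P}" for i
  have fin: "finite {j. (i, j) \<in> Y}" "finite {j. (i, j) \<in> P}" for i
    by (auto intro!: finite_subset[of _ "{..<n}"] dest!: subsetD[OF Ysub] subsetD[OF P(1)])
  have sub: "{j. (i, j) \<in> Y} \<subseteq> {j. (i', j) \<in> Y} \<union> {j. (i', j) \<in> P}" if "near i i'" "i' < n" for i i'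
  proof
    fix j assume "j \<in> {j. (i, j) \<in> Y}"
    then show "j \<in> {j. (i', j) \<in> Y} \<union> {j. (i', j) \<in> P}"
      using cut_offD[OF Y, of "(i, j)" "(i', j)"] Ysub that by (auto simp: adj2_def)
  qed
  have step: "y i \<le> y i' + p i'" if "near i i'" "i' < n" for i i'
  proof -
    have "y i \<le> card ({j. (i', j) \<in> Y} \<union> {j. (i', j) \<in> P})"
      unfolding y_def using sub[OF that] fin by (intro card_mono) auto
    also have "\<dots> \<le> y i' + p i'" unfolding y_def p_def by (rule card_Un_le)
    finally show ?thesis .
  qed
  have "2 * (\<Sum>i<n. y i) \<le> card P * (card P - 1)"
  proof (rule triangular_bound)
    show "0 < p i" if "0 < y i" for i
    proof -
      have "{j. (i, j) \<in> Y} \<noteq> {}" using that unfolding y_def by (metis card.empty less_irrefl)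
      then obtain j where "(i, j) \<in> Y" by blast
      then obtain j' where "(i, j') \<in> P" using rows by blast
      then have "{j. (i, j) \<in> P} \<noteq> {}" by blast
      then show ?thesis using fin(2)[of i] by (simp add: p_def card_gt_0_iff)
    qed
    show "(\<Sum>i<n. p i) = card P" unfolding p_def using card_eq_sum_rows[OF P(1)] by simp
    show "y (Suc i) \<le> y i + p i" if "Suc i < n" for i
      using step[of "Suc i" i] that by (simp add: near_def)
    show "y i \<le> y (Suc i) + p (Suc i)" if "Suc i < n" for i
      using step[of i "Suc i"] that by (simp add: near_def)
    show "card P < n" using P by simp
  qed
  also have "\<dots> \<le> q * (q - 1)" using P by (intro mult_le_mono) auto
  finally show ?thesis using card_eq_sum_rows[OF Ysub] by (simp add: y_def)
qed

text \<open>
  If a row without cops met \<open>X\<close>, it would lie in \<open>X\<close>, and by its crossing with the free column \<open>j0\<close>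
  the whole column would.
\<close>

lemma cut_off_small_of_column:
  assumes X: "cut_off adj2 (square n) P X" and P: "P \<subseteq> square n" "card P \<le> q" "q < n"
    and col: "\<And>i. (i, j0) \<notin> P" and out: "i0 < n" "j0 < n" "(i0, j0) \<notin> X"
  shows "2 * card X \<le> q * (q - 1)"
proof (rule cut_off_square_bound[OF X P])
  fix i j assume ij: "(i, j) \<in> X"
  then have lt: "i < n" "j < n" using cut_off_subset[OF X] by auto
  show "\<exists>j'. (i, j') \<in> P"
  proof (rule ccontr)
    assume none: "\<not> ?thesis"
    have "(i, j0) \<in> X"
      by (rule cut_off_line[where f = "\<lambda>t. (i, t)" and a = j, OF symp_adj(1) X]) (use none lt ij out in auto)
    have "(i0, j0) \<in> X"
      by (rule cut_off_line[where f = "\<lambda>t. (t, j0)" and a = i, OF symp_adj(1) X]) (use \<open>(i, j0) \<in> X\<close> lt col out in auto)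
    then show False using out by simp
  qed
qed

lemma free_column:
  assumes "card P < n" "finite P"
  obtains j0 :: nat where "j0 < n" "\<And>i. (i, j0) \<notin> P"
proof -
  have "card (snd ` P) < card {..<n}" using assms card_image_le[of P snd] by simp
  then have "\<not> {..<n} \<subseteq> snd ` P" using assms(2) card_mono[of "snd ` P" "{..<n}"] by auto
  then show ?thesis using that by (force simp: image_iff)
qed

lemma cut_off_small_of_row:
  assumes X: "cut_off adj2 (square n) P X" and P: "P \<subseteq> square n" "card P \<le> q" "q < n"
    and row: "\<And>j. (i, j) \<notin> P" and out: "i < n" "j < n" "(i, j) \<notin> X"
  shows "2 * card X \<le> q * (q - 1)"
proof -
  obtain j0 where j0: "j0 < n" "\<And>i. (i, j0) \<notin> P"
    using free_column[of P n] P finite_subset[OF P(1)] by auto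
  have "(i, j0) \<notin> X"
  proof
    assume in_X: "(i, j0) \<in> X"
    have "(i, j) \<in> X"
      by (rule cut_off_line[where f = "\<lambda>t. (i, t)" and a = j0, OF symp_adj(1) X]) (use in_X row j0 out in auto)
    then show False using out by simp
  qed
  then show ?thesis using cut_off_small_of_column[OF X P j0(2) out(1) j0(1)] by simp
qed

text \<open>
  There is a free column, which lies either in \<open>X\<close> or in the rest, and the other of the two is small.
\<close>

lemma cut_off_dichotomy:
  assumes X: "cut_off adj2 (square n) P X" and P: "P \<subseteq> square n" "card P \<le> q" "q < n"
  shows "2 * card X \<le> q * (q - 1) \<or> 2 * card (square n - P - X) \<le> q * (q - 1)"
proof -
  obtain j0 where j0: "j0 < n" "\<And>i. (i, j0) \<notin> P"
    using free_column[of P n] P finite_subset[OF P(1)] by auto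
  show ?thesis
  proof (cases "(0, j0) \<in> X")
    case True
    then have "2 * card (square n - P - X) \<le> q * (q - 1)"
      using j0 by (intro cut_off_small_of_column[OF cut_off_complement[OF symp_adj(1) X] P, of j0 0]) auto
    then show ?thesis ..
  next
    case False
    then have "2 * card X \<le> q * (q - 1)"
      using j0 by (intro cut_off_small_of_column[OF X P, of j0 0]) auto
    then show ?thesis ..
  qed
qed

abbreviation slice :: "nat \<Rightarrow> (nat \<times> nat \<times> nat) set \<Rightarrow> (nat \<times> nat) set" where
  "slice h A \<equiv> Pair h -` A"

lemma cut_off_slice:
  assumes "cut_off adj3 (cube n) S K" "h < n"
  shows "cut_off adj2 (square n) (slice h S) (slice h K)"
  using assms unfolding cut_off_def by (fastforce simp: adj3_def cube_def)

lemma slice_subset: "A \<subseteq> cube n \<Longrightarrow> slice h A \<subseteq> square n"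
  by (auto simp: cube_def)

lemma finite_slice: "A \<subseteq> cube n \<Longrightarrow> finite (slice h A)"
  by (rule finite_subset[OF slice_subset]) auto

text \<open>
  A vertex of \<open>K\<close> lies next to a vertex of \<open>K\<close> or to a cop in the neighbouring layer.
\<close>

lemma card_slice_step:
  assumes K: "cut_off adj3 (cube n) S K" and S: "S \<subseteq> cube n" and "near h h'" "h' < n"
  shows "card (slice h K) \<le> card (slice h' K) + card (slice h' S)"
proof -
  have Ks: "K \<subseteq> cube n" using cut_off_subset[OF K] by blast
  have "slice h K \<subseteq> slice h' K \<union> slice h' S"
  proof
    fix u assume "u \<in> slice h K"
    then show "u \<in> slice h' K \<union> slice h' S"
      using cut_offD[OF K, of "(h, u)" "(h', u)"] Ks assms by (auto simp: adj3_def)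
  qed
  then have "card (slice h K) \<le> card (slice h' K \<union> slice h' S)"
    using finite_slice[OF Ks] finite_slice[OF S] by (intro card_mono) auto
  then show ?thesis using card_Un_le le_trans by blast
qed

section \<open>The cost of a boundary between two thin layers\<close>

text \<open>
  The term \<open>real p\<close> on the right is there because \<open>n\<^sup>2 - a\<close> counts the cops of the layer along with
  the rest.
\<close>

lemma slice_isoperimetry:
  assumes K: "cut_off adj3 (cube n) S K" and S: "S \<subseteq> cube n" "card (slice h S) \<le> p"
    and h: "h < n"
  defines "a \<equiv> real (card (slice h K))"
  shows "real n \<le> real p \<or> 2 * a \<le> (real p)\<^sup>2 \<or> 2 * ((real n)\<^sup>2 - a) \<le> (real p)\<^sup>2 + real p"
    and "2 * card (square n - slice h S - slice h K) \<le> p * (p - 1) \<Longrightarrow>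
      2 * ((real n)\<^sup>2 - a) \<le> (real p)\<^sup>2 + real p"
proof -
  note X = cut_off_slice[OF K h]
  have Ks: "K \<subseteq> cube n" using cut_off_subset[OF K] by blast
  have sub: "slice h K \<subseteq> square n - slice h S" using cut_off_subset[OF X] .
  have sq: "real (p * (p - 1)) \<le> (real p)\<^sup>2 - real p"
    by (cases p) (auto simp: power2_eq_square algebra_simps)
  have "card (square n - slice h S - slice h K) = card (square n) - card (slice h S) - card (slice h K)"
    using sub slice_subset[OF S(1)] finite_slice[OF S(1)] finite_slice[OF Ks]
    by (simp add: card_Diff_subset)
  then have n: "n\<^sup>2 \<le> card (square n - slice h S - slice h K) + card (slice h S) + card (slice h K)" by simp
  have n': "(real n)\<^sup>2 \<le> real (card (square n - slice h S - slice h K)) + real p + a"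
  proof -
    have "real (n\<^sup>2) \<le> real (card (square n - slice h S - slice h K) + p + card (slice h K))"
      unfolding of_nat_le_iff using n S by linarith
    then show ?thesis by (simp add: a_def)
  qed
  show big: "2 * ((real n)\<^sup>2 - a) \<le> (real p)\<^sup>2 + real p"
    if "2 * card (square n - slice h S - slice h K) \<le> p * (p - 1)"
  proof -
    have "real (2 * card (square n - slice h S - slice h K)) \<le> real (p * (p - 1))"
      using that unfolding of_nat_le_iff .
    then show ?thesis using n' sq by simp
  qed
  show "real n \<le> real p \<or> 2 * a \<le> (real p)\<^sup>2 \<or> 2 * ((real n)\<^sup>2 - a) \<le> (real p)\<^sup>2 + real p"
  proof (cases "n \<le> p")
    case False
    then have "2 * card (slice h K) \<le> p * (p - 1) \<or> 2 * card (square n - slice h S - slice h K) \<le> p * (p - 1)"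
      using S slice_subset[OF S(1)] by (intro cut_off_dichotomy[OF X]) auto
    then show ?thesis
    proof
      assume "2 * card (slice h K) \<le> p * (p - 1)"
      then have "real (2 * card (slice h K)) \<le> real (p * (p - 1))" unfolding of_nat_le_iff .
      then show ?thesis using sq by (simp add: a_def)
    next
      assume "2 * card (square n - slice h S - slice h K) \<le> p * (p - 1)"
      then show ?thesis using big by blast
    qed
  qed simp
qed

text \<open>
  A telescoping sum of \<open>potential_step\<close>. It stops at \<open>z2 - 1\<close>, as the step to \<open>z2\<close> has at most
  \<open>\<mu>\<close> cops; but so few cops change the area so little that the potential at \<open>z2 - 1\<close> is
  already within 1/2 of its least value.
\<close>

lemma crossing_cost:
  fixes p :: "nat \<Rightarrow> nat" and \<mu> :: real
  assumes K: "cut_off adj3 (cube n) S K" and S: "S \<subseteq> cube n" "\<And>h. h < n \<Longrightarrow> card (slice h S) \<le> p h"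
    and z: "z1 < z2" "z2 < n" "p z1 \<le> \<mu>" "p z2 \<le> \<mu>"
    and thick: "\<And>h. z1 < h \<Longrightarrow> h < z2 \<Longrightarrow> \<mu> < p h"
    and big: "2 * card (square n - slice z1 S - slice z1 K) \<le> p z1 * (p z1 - 1)"
    and small: "2 * card (slice z2 K) \<le> p z2 * (p z2 - 1)"
    and \<mu>: "0 \<le> \<mu>" "\<mu> + 1 \<le> n"
  shows "(real n - \<mu>)\<^sup>2 - 1 \<le> (\<Sum>h\<in>{z1<..<z2}. p h - \<mu> + 1)"
proof -
  define a where "a h = real (card (slice h K))" for h
  have Ks: "K \<subseteq> cube n" using cut_off_subset[OF K] by blast
  have a_le: "a h \<le> (real n)\<^sup>2" for h
  proof -
    have "card (slice h K) \<le> n\<^sup>2" using card_mono[OF finite_square slice_subset[OF Ks]] by simp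
    then show ?thesis unfolding a_def by (metis of_nat_le_iff of_nat_power)
  qed
  have a_step: "a h - a h' \<le> p h'" if "near h h'" "h' < n" for h h'
    using card_slice_step[OF K S(1) that] S(2)[OF that(2)] by (simp add: a_def)
  have p2: "(real (p h))\<^sup>2 + real (p h) \<le> (\<mu> + 1)\<^sup>2" if "p h \<le> \<mu>" for h
  proof -
    have "(real (p h))\<^sup>2 \<le> \<mu>\<^sup>2" using that by (intro power_mono) auto
    then show ?thesis using that \<mu> by (simp add: power2_eq_square algebra_simps)
  qed
  have tele: "potential n \<mu> (a z1) - potential n \<mu> (a t) \<le> (\<Sum>h\<in>{z1<..t}. p h - \<mu> + 1)"
    if "z1 \<le> t" "t < z2" for t
    using that
  proof (induction t rule: dec_induct)
    case base then show ?case by simp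
  next
    case (step t)
    have lt: "Suc t < n" "Suc t < z2" using step.prems z by auto
    have "potential n \<mu> (a t) - potential n \<mu> (a (Suc t)) \<le> p (Suc t) - \<mu> + 1"
    proof (rule potential_step)
      show "a t - a (Suc t) \<le> real (p (Suc t))"
        using a_step[of t "Suc t"] lt(1) by (simp add: near_def)
      show "\<mu> \<le> real (p (Suc t))" using thick[of "Suc t"] step.hyps lt(2) by simp
      show "real n \<le> p (Suc t) \<or> 2 * a (Suc t) \<le> (real (p (Suc t)))\<^sup>2
          \<or> 2 * ((real n)\<^sup>2 - a (Suc t)) \<le> (real (p (Suc t)))\<^sup>2 + real (p (Suc t))"
        using slice_isoperimetry(1)[OF K S(1) S(2)[OF lt(1)] lt(1)] by (simp add: a_def)
    qed (use a_le \<mu> z in \<open>auto simp: a_def\<close>)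
    moreover have "{z1<..Suc t} = insert (Suc t) {z1<..t}" using step.hyps by auto
    ultimately show ?case using step.IH lt(2) by simp
  qed
  have "(real n - \<mu>)\<^sup>2 / 2 - 1 / 2 \<le> potential n \<mu> (a z1)"
    using slice_isoperimetry(2)[OF K S(1) S(2) _ big] p2[of z1] z \<mu>
    by (intro potential_start) (auto simp: a_def)
  moreover have "potential n \<mu> (a (z2 - 1)) \<le> 1 / 2 - (real n - \<mu>)\<^sup>2 / 2"
  proof (rule potential_end)
    have "a (z2 - 1) - a z2 \<le> p z2" using a_step[of "z2 - 1" z2] z by (simp add: near_def)
    moreover have "real (2 * card (slice z2 K)) \<le> real (p z2 * (p z2 - 1))"
      using small unfolding of_nat_le_iff .
    moreover have "real (p z2 * (p z2 - 1)) \<le> (real (p z2))\<^sup>2 - real (p z2)"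
      by (cases "p z2") (auto simp: power2_eq_square algebra_simps)
    ultimately show "2 * a (z2 - 1) \<le> (\<mu> + 1)\<^sup>2" using p2[OF z(4)] by (simp add: a_def)
  qed (use \<mu> in auto)
  moreover have "potential n \<mu> (a z1) - potential n \<mu> (a (z2 - 1)) \<le> (\<Sum>h\<in>{z1<..<z2}. p h - \<mu> + 1)"
  proof -
    have "{z1<..z2 - 1} = {z1<..<z2}" using z by auto
    then show ?thesis using tele[of "z2 - 1"] z by simp
  qed
  ultimately show ?thesis by linarith
qed

lemma window_sum:
  fixes f :: "nat \<Rightarrow> nat" and L :: real
  assumes W: "0 < W" and ab: "a \<le> b" and L: "0 \<le> L"
    and win: "\<And>h. a \<le> h \<Longrightarrow> h + W \<le> b \<Longrightarrow> L \<le> real (\<Sum>i\<in>{h..<h + W}. f i)"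
  shows "(real (b - a) / real W - 1) * L \<le> real (\<Sum>i\<in>{a..<b}. f i)"
proof -
  define c where "c = (b - a) div W"
  have cW: "c * W \<le> b - a" by (simp add: c_def)
  have shift: "(\<Sum>i\<in>{a + q * W..<a + q * W + W}. f i) = (\<Sum>i\<in>{q * W..<q * W + W}. f (a + i))" for q
    using sum.shift_bounds_nat_ivl[of f "q * W" a "q * W + W"] by (simp add: ac_simps)
  have "real c * L = (\<Sum>q<c. L)" by simp
  also have "\<dots> \<le> (\<Sum>q<c. real (\<Sum>i\<in>{a + q * W..<a + q * W + W}. f i))"
  proof (rule sum_mono)
    fix q assume "q \<in> {..<c}"
    then have "(q + 1) * W \<le> c * W" by (intro mult_le_mono1) auto
    then show "L \<le> real (\<Sum>i\<in>{a + q * W..<a + q * W + W}. f i)"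
      using cW ab by (intro win) auto
  qed
  also have "\<dots> = real (\<Sum>q<c. \<Sum>i\<in>{q * W..<q * W + W}. f (a + i))"
    by (simp only: shift of_nat_sum)
  also have "\<dots> = real (\<Sum>i<c * W. f (a + i))" by (simp add: sum.nat_group)
  also have "\<dots> \<le> real (\<Sum>i<b - a. f (a + i))"
    unfolding of_nat_le_iff using cW by (intro sum_mono2) auto
  also have "(\<Sum>i<b - a. f (a + i)) = (\<Sum>i\<in>{a..<b}. f i)"
    using ab by (simp add: sum.atLeastLessThan_shift_0[of f a b] lessThan_atLeast0)
  finally have "real c * L \<le> real (\<Sum>i\<in>{a..<b}. f i)" .
  moreover have "real (b - a) / real W - 1 \<le> real c"
  proof -
    have "b - a < Suc c * W" using W by (simp add: c_def dividend_less_div_times)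
    then have "real (b - a) < real (Suc c * W)" unfolding of_nat_less_iff .
    then show ?thesis using W by (simp add: field_simps)
  qed
  ultimately show ?thesis using L by (meson mult_right_mono order_trans)
qed

text \<open>
  Here \<open>W\<close> is the length of the blocks that contain at least \<open>L\<close> cops. In a layer with at most
  \<open>\<mu>\<close> cops either \<open>K\<close> or its complement is small, so there are two consecutive ones among these
  layers at which this changes. \<open>crossing_cost\<close> applies to the layers between the two, and
  the layers on both sides are estimated by blocks.
\<close>

lemma two_thin_slices_cost:
  fixes p :: "nat \<Rightarrow> nat" and \<mu> L :: real
  assumes K: "cut_off adj3 (cube n) S K" and S: "S \<subseteq> cube n" "\<And>h. h < n \<Longrightarrow> card (slice h S) \<le> p h"
    and z: "z1 < z2" "z2 < n" "p z1 \<le> \<mu>" "p z2 \<le> \<mu>"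
    and big: "2 * card (square n - slice z1 S - slice z1 K) \<le> p z1 * (p z1 - 1)"
    and small: "2 * card (slice z2 K) \<le> p z2 * (p z2 - 1)"
    and \<mu>: "0 \<le> \<mu>" "\<mu> + 1 \<le> n"
    and W: "0 < W" "0 \<le> L" "L \<le> \<mu> * W"
    and win: "\<And>h. h + W \<le> n \<Longrightarrow> L \<le> real (\<Sum>i\<in>{h..<h + W}. p i)"
  shows "L / W * n - 2 * L + (real n - \<mu>)\<^sup>2 - n - 1 \<le> real (\<Sum>h<n. p h)"
proof -
  define Big where "Big h \<longleftrightarrow> 2 * card (square n - slice h S - slice h K) \<le> p h * (p h - 1)" for h
  \<comment> \<open>\<open>x\<close> is the last thin layer before \<open>z2\<close> in which \<open>K\<close> is large, and \<open>y\<close> the next thin one.\<close>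
  define x where "x = Max {h. h < z2 \<and> p h \<le> \<mu> \<and> Big h}"
  define y where "y = Min {h. x < h \<and> h < n \<and> p h \<le> \<mu>}"
  have "x \<in> {h. h < z2 \<and> p h \<le> \<mu> \<and> Big h}"
    unfolding x_def by (rule Max_in) (use z big in \<open>auto simp: Big_def\<close>)
  then have x: "x < z2" "p x \<le> \<mu>" "Big x" by auto
  have x_max: "h \<le> x" if "h < z2" "p h \<le> \<mu>" "Big h" for h
    unfolding x_def by (rule Max_ge) (use that in auto)
  have "y \<in> {h. x < h \<and> h < n \<and> p h \<le> \<mu>}"
    unfolding y_def by (rule Min_in) (use z x in auto)
  then have y: "x < y" "y < n" "p y \<le> \<mu>" by auto
  have y_min: "y \<le> h" if "x < h" "h < n" "p h \<le> \<mu>" for h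
    unfolding y_def by (rule Min_le) (use that in auto)
  have small_y: "2 * card (slice y K) \<le> p y * (p y - 1)"
  proof (cases "y = z2")
    case True then show ?thesis using small by simp
  next
    case False
    then have "y < z2" using y_min[of z2] x z by simp
    then have "\<not> Big y" using x_max[of y] y by auto
    then show ?thesis
      using cut_off_dichotomy[OF cut_off_slice[OF K y(2)] slice_subset[OF S(1)] S(2)[OF y(2)]] y \<mu>
      by (auto simp: Big_def)
  qed
  have mid: "(real n - \<mu>)\<^sup>2 - 1 \<le> (\<Sum>h\<in>{x<..<y}. p h - \<mu> + 1)"
  proof (rule crossing_cost[OF K S y(1,2) x(2) y(3) _ _ small_y \<mu>])
    show "\<mu> < p h" if "x < h" "h < y" for h using y_min[of h] that y by force
    show "2 * card (square n - slice x S - slice x K) \<le> p x * (p x - 1)" using x by (simp add: Big_def)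
  qed auto
  have pre: "(real (Suc x) / W - 1) * L \<le> real (\<Sum>h\<in>{0..<Suc x}. p h)"
    using window_sum[of W 0 "Suc x" L p] W win y by simp
  have post: "(real (n - y) / W - 1) * L \<le> real (\<Sum>h\<in>{y..<n}. p h)"
    using window_sum[of W y n L p] W win y by simp
  have "(\<Sum>h\<in>{x<..<y}. p h - \<mu> + 1) = real (\<Sum>h\<in>{x<..<y}. p h) - real (y - Suc x) * (\<mu> - 1)"
    by (simp add: sum.distrib sum_subtractf algebra_simps)
  moreover have "real (y - Suc x) * (L / W) \<le> real (y - Suc x) * \<mu>"
    using W by (intro mult_left_mono) (auto simp: field_simps)
  moreover have "real (y - Suc x) \<le> n" using y by simp
  ultimately have mid': "(real n - \<mu>)\<^sup>2 - 1 + real (y - Suc x) * (L / W) - n \<le> real (\<Sum>h\<in>{x<..<y}. p h)"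
    using mid by (simp add: algebra_simps)
  have "{..<n} = {0..<Suc x} \<union> {x<..<y} \<union> {y..<n}" using y by auto
  then have "(\<Sum>h<n. p h) = (\<Sum>h\<in>{0..<Suc x} \<union> {x<..<y} \<union> {y..<n}. p h)" by simp
  also have "\<dots> = (\<Sum>h\<in>{0..<Suc x}. p h) + (\<Sum>h\<in>{x<..<y}. p h) + (\<Sum>h\<in>{y..<n}. p h)"
    using y by (subst sum.union_disjoint; (subst sum.union_disjoint)?) auto
  finally have tot: "real (\<Sum>h<n. p h) = real (\<Sum>h\<in>{0..<Suc x}. p h) + real (\<Sum>h\<in>{x<..<y}. p h) + real (\<Sum>h\<in>{y..<n}. p h)"
    by simp
  have "real n = real (Suc x) + real (y - Suc x) + real (n - y)" using y by simp
  then have "L / W * n = real (Suc x) / W * L + real (y - Suc x) * (L / W) + real (n - y) / W * L"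
    by (metis (no_types, opaque_lifting) distrib_left mult.commute times_divide_eq_right)
  then show ?thesis unfolding tot using pre post mid' by (simp add: algebra_simps)
qed

section \<open>Slabs, tubes and the moves of the cops\<close>

text \<open>
  Cops are counted rather than occupied vertices, because cops that share a vertex before a turn may occupy
  different vertices after it.
\<close>

definition cops_in :: "nat \<Rightarrow> (nat \<Rightarrow> 'a) \<Rightarrow> 'a set \<Rightarrow> nat" where
  "cops_in k c A = card {q. q < k \<and> c q \<in> A}"

lemma cops_in_partition:
  assumes "finite I"
  shows "cops_in k c {v \<in> A. f v \<in> I} = (\<Sum>i\<in>I. cops_in k c {v \<in> A. f v = i})"
proof -
  have "{q. q < k \<and> c q \<in> {v \<in> A. f v \<in> I}} = (\<Union>i\<in>I. {q. q < k \<and> c q \<in> {v \<in> A. f v = i}})"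
    by auto
  also have "card \<dots> = (\<Sum>i\<in>I. card {q. q < k \<and> c q \<in> {v \<in> A. f v = i}})"
    using assms by (intro card_UN_disjoint) auto
  finally show ?thesis by (simp only: cops_in_def)
qed

lemma cops_in_mono: "A \<subseteq> B \<Longrightarrow> cops_in k c A \<le> cops_in k c B"
  unfolding cops_in_def by (intro card_mono) auto

lemma cops_in_le: "cops_in k c A \<le> k"
proof -
  have "card {q. q < k \<and> c q \<in> A} \<le> card {..<k}" by (intro card_mono) auto
  then show ?thesis by (simp add: cops_in_def)
qed

lemma card_image_cops_le:
  assumes "\<And>x. x \<in> X \<Longrightarrow> \<exists>q<k. c q \<in> A \<and> x = f (c q)"
  shows "card X \<le> cops_in k c A"
proof -
  have "X \<subseteq> (\<lambda>q. f (c q)) ` {q. q < k \<and> c q \<in> A}" using assms by blast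
  then have "card X \<le> card {q. q < k \<and> c q \<in> A}" by (intro surj_card_le) auto
  then show ?thesis by (simp add: cops_in_def)
qed

definition cop_turn :: "nat \<Rightarrow> (nat \<Rightarrow> nat \<times> nat \<times> nat) \<Rightarrow> (nat \<Rightarrow> nat \<times> nat \<times> nat) \<Rightarrow> bool" where
  "cop_turn k c c' \<longleftrightarrow> (\<forall>q<k. c' q = c q \<or> adj3 (c q) (c' q))"

lemma cops_in_after_turn:
  assumes "cop_turn k c c'" "\<And>u v. v \<in> A \<Longrightarrow> adj3 u v \<Longrightarrow> u \<in> B" "A \<subseteq> B"
  shows "cops_in k c' A \<le> cops_in k c B"
proof -
  have "{q. q < k \<and> c' q \<in> A} \<subseteq> {q. q < k \<and> c q \<in> B}"
  proof
    fix q assume q: "q \<in> {q. q < k \<and> c' q \<in> A}"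
    then have "c' q = c q \<or> adj3 (c q) (c' q)" using assms(1) by (simp add: cop_turn_def)
    then show "q \<in> {q. q < k \<and> c q \<in> B}" using q assms(2)[of "c' q" "c q"] assms(3) by auto
  qed
  then show ?thesis unfolding cops_in_def by (intro card_mono) auto
qed

lemma cops_in_before_turn:
  assumes "cop_turn k c c'" "\<And>u v. u \<in> A \<Longrightarrow> adj3 u v \<Longrightarrow> v \<in> B" "A \<subseteq> B"
  shows "cops_in k c A \<le> cops_in k c' B"
proof -
  have "{q. q < k \<and> c q \<in> A} \<subseteq> {q. q < k \<and> c' q \<in> B}"
  proof
    fix q assume q: "q \<in> {q. q < k \<and> c q \<in> A}"
    then have "c' q = c q \<or> adj3 (c q) (c' q)" using assms(1) by (simp add: cop_turn_def)
    then show "q \<in> {q. q < k \<and> c' q \<in> B}" using q assms(2)[of "c q" "c' q"] assms(3) by auto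
  qed
  then show ?thesis unfolding cops_in_def by (intro card_mono) auto
qed

definition slab :: "nat \<Rightarrow> nat \<Rightarrow> (nat \<times> nat \<times> nat) set" where
  "slab h w = {v. h \<le> fst v \<and> fst v < h + w}"

abbreviation layer :: "nat \<Rightarrow> (nat \<times> nat \<times> nat) set" where
  "layer h \<equiv> {v. fst v = h}"

lemma cops_in_slab: "cops_in k c (slab h w) = (\<Sum>i\<in>{h..<h + w}. cops_in k c (layer i))"
  using cops_in_partition[of "{h..<h + w}" k c UNIV fst] by (simp add: slab_def)

lemma adj3_fst: "adj3 u v \<Longrightarrow> fst u \<le> Suc (fst v) \<and> fst v \<le> Suc (fst u)"
  by (auto simp: adj3_def near_def)

lemma exists_small_summand:
  fixes f :: "nat \<Rightarrow> nat"
  assumes "finite I" "I \<noteq> {}" "sum f I \<le> s"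
  shows "\<exists>i\<in>I. card I * f i \<le> s"
proof (rule ccontr)
  assume "\<not> ?thesis"
  then have "\<And>i. i \<in> I \<Longrightarrow> s + 1 \<le> card I * f i" by force
  then have "(\<Sum>i\<in>I. s + 1) \<le> (\<Sum>i\<in>I. card I * f i)" by (rule sum_mono)
  also have "\<dots> = card I * sum f I" by (simp add: sum_distrib_left)
  also have "\<dots> \<le> card I * s" using assms by simp
  finally show False using assms by (simp add: card_eq_0_iff)
qed

definition slab_min :: "nat \<Rightarrow> nat \<Rightarrow> nat \<Rightarrow> (nat \<Rightarrow> nat \<times> nat \<times> nat) \<Rightarrow> nat" where
  "slab_min n w k c = Min ((\<lambda>h. cops_in k c (slab h w)) ` {0..n - w})"

lemma slab_min_le: "h + w \<le> n \<Longrightarrow> slab_min n w k c \<le> cops_in k c (slab h w)"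
  unfolding slab_min_def by (rule Min_le) auto

lemma slab_min_attained:
  obtains h where "h \<le> n - w" "cops_in k c (slab h w) = slab_min n w k c"
proof -
  have "slab_min n w k c \<in> (\<lambda>h. cops_in k c (slab h w)) ` {0..n - w}"
    unfolding slab_min_def by (rule Min_in) auto
  then show ?thesis using that by auto
qed

text \<open>
  A vertex in a free row of a layer whose number of cops is at most the average in the sparsest slab.
  By \<open>cut_off_small_of_row\<close>, such a row lies in the large part of its layer.
\<close>

definition anchor :: "nat \<Rightarrow> nat \<Rightarrow> nat \<Rightarrow> (nat \<Rightarrow> nat \<times> nat \<times> nat) \<Rightarrow> nat \<times> nat \<times> nat \<Rightarrow> bool" where
  "anchor n w k c v \<longleftrightarrow> (\<exists>h i j. v = (h, i, j) \<and> v \<in> cube n \<and>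
     w * cops_in k c (layer h) \<le> slab_min n w k c \<and> (\<forall>q<k. \<forall>j. c q \<noteq> (h, i, j)))"

lemma sum_consecutive_blocks_le:
  fixes f :: "nat \<Rightarrow> nat"
  shows "(\<Sum>q<n div w. \<Sum>j\<in>{q * w..<q * w + w}. f j) \<le> (\<Sum>j<n. f j)"
proof -
  have "(\<Sum>q<n div w. \<Sum>j\<in>{q * w..<q * w + w}. f j) = (\<Sum>j<n div w * w. f j)" by (simp add: sum.nat_group)
  also have "\<dots> \<le> (\<Sum>j<n. f j)" by (intro sum_mono2) auto
  finally show ?thesis .
qed

lemma block_le:
  assumes "q < n div w"
  shows "q * w + w \<le> (n::nat)"
proof -
  have "(q + 1) * w \<le> n div w * w" using assms by (intro mult_le_mono1) auto
  also have "\<dots> \<le> n" by (rule div_times_less_eq_dividend)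
  finally show ?thesis by simp
qed

lemma slab_min_times_div_le: "n div w * slab_min n w k c \<le> k"
proof -
  have "n div w * slab_min n w k c = (\<Sum>q<n div w. slab_min n w k c)" by simp
  also have "\<dots> \<le> (\<Sum>q<n div w. \<Sum>j\<in>{q * w..<q * w + w}. cops_in k c (layer j))"
    unfolding cops_in_slab[symmetric] by (intro sum_mono slab_min_le block_le) auto
  also have "\<dots> \<le> (\<Sum>j<n. cops_in k c (layer j))" by (rule sum_consecutive_blocks_le)
  also have "\<dots> = cops_in k c (slab 0 n)" by (simp add: cops_in_slab lessThan_atLeast0)
  also have "\<dots> \<le> k" by (rule cops_in_le)
  finally show ?thesis .
qed

definition tube :: "nat \<Rightarrow> nat \<Rightarrow> nat \<Rightarrow> (nat \<times> nat \<times> nat) set" where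
  "tube h j w = {v \<in> slab h w. j \<le> snd (snd v) \<and> snd (snd v) < j + w}"

lemma exists_light_tube:
  assumes "0 < w" "w \<le> n"
  shows "\<exists>j. j + w \<le> n \<and> n div w * cops_in k c (tube h j w) \<le> cops_in k c (slab h w)"
proof -
  define f where "f j = cops_in k c {v \<in> slab h w. snd (snd v) = j}" for j
  have t: "cops_in k c (tube h j w) = (\<Sum>i\<in>{j..<j + w}. f i)" for j
    using cops_in_partition[of "{j..<j + w}" k c "slab h w" "\<lambda>v. snd (snd v)"]
    by (simp add: tube_def f_def)
  have "(\<Sum>q<n div w. cops_in k c (tube h (q * w) w)) \<le> (\<Sum>j<n. f j)"
    unfolding t by (rule sum_consecutive_blocks_le)
  also have "\<dots> \<le> cops_in k c (slab h w)"
    using cops_in_partition[of "{..<n}" k c "slab h w" "\<lambda>v. snd (snd v)"]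
      cops_in_mono[of "{v \<in> slab h w. snd (snd v) \<in> {..<n}}" "slab h w" k c]
    by (auto simp: f_def)
  finally have "\<exists>q\<in>{..<n div w}. card {..<n div w} * cops_in k c (tube h (q * w) w) \<le> cops_in k c (slab h w)"
    using assms by (intro exists_small_summand) (auto simp: div_eq_0_iff lessThan_empty_iff)
  then show ?thesis using block_le by auto
qed

text \<open>
  The positions along the tube \<open>T\<close> whose cross-section has no cop of \<open>T\<close> in it or next to it.
  After one cop turn the inner part of such a cross-section is still free.
\<close>

definition quiet :: "nat \<Rightarrow> nat \<Rightarrow> (nat \<Rightarrow> nat \<times> nat \<times> nat) \<Rightarrow> (nat \<times> nat \<times> nat) set \<Rightarrow> nat set" where
  "quiet n k c T = {i. i < n \<and> (\<forall>q<k. c q \<in> T \<longrightarrow> fst (snd (c q)) \<noteq> i \<and> \<not> near (fst (snd (c q))) i)}"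

lemma card_quiet: "n \<le> card (quiet n k c T) + 3 * cops_in k c T"
proof -
  have eq: "{..<n} - quiet n k c T \<subseteq> (\<Union>q\<in>{q. q < k \<and> c q \<in> T}. {fst (snd (c q)) - 1, fst (snd (c q)), fst (snd (c q)) + 1})"
    by (auto simp: quiet_def near_def)
  have "card ({..<n} - quiet n k c T) \<le> card (\<Union>q\<in>{q. q < k \<and> c q \<in> T}. {fst (snd (c q)) - 1, fst (snd (c q)), fst (snd (c q)) + 1})"
    by (intro card_mono eq) auto
  also have "\<dots> \<le> (\<Sum>q\<in>{q. q < k \<and> c q \<in> T}. card {fst (snd (c q)) - 1, fst (snd (c q)), fst (snd (c q)) + 1})"
    by (intro card_UN_le) auto
  also have "\<dots> \<le> (\<Sum>q\<in>{q. q < k \<and> c q \<in> T}. 3)"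
    by (intro sum_mono) (simp add: card_insert_if)
  also have "\<dots> = 3 * cops_in k c T" by (simp add: cops_in_def)
  finally have "card ({..<n} - quiet n k c T) \<le> 3 * cops_in k c T" .
  moreover have "card {..<n} - card (quiet n k c T) \<le> card ({..<n} - quiet n k c T)"
    by (rule diff_card_le_card_Diff) (auto simp: quiet_def)
  ultimately show ?thesis by simp
qed

lemma quiet_section_free:
  assumes "cop_turn k c c'" "i \<in> quiet n k c (tube h0 j0 w)"
    and "h0 < h" "h + 1 < h0 + w" "j0 < j" "j + 1 < j0 + w" "q < k"
  shows "c' q \<noteq> (h, i, j)"
proof
  assume eq: "c' q = (h, i, j)"
  obtain a b d where abd: "c q = (a, b, d)" by (cases "c q")
  have "c q = (h, i, j) \<or> adj3 (c q) (h, i, j)" using assms eq by (auto simp: cop_turn_def)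
  then have "c q \<in> tube h0 j0 w" "fst (snd (c q)) = i \<or> near (fst (snd (c q))) i"
    using assms(3-6) by (auto simp: abd tube_def slab_def adj3_def adj2_def near_def)
  then show False using assms by (auto simp: quiet_def)
qed

text \<open>
  Cops on an inner line of the tube after their turn were inside the tube before. As there are
  \<open>(w - 2)\<^sup>2\<close> inner lines, one of them, through \<open>(hs, js)\<close>, has no cop; the inner part of a quiet
  cross-section is a free square that meets this line.
\<close>

lemma core_connected:
  assumes turn: "cop_turn k c c'" and light: "cops_in k c (tube h0 j0 w) < (w - 2) * (w - 2)"
    and fit: "h0 + w \<le> n" "j0 + w \<le> n" "3 \<le> w"
    and K: "cut_off adj3 (cube n) (c' ` {..<k}) K"
    and i0: "i0 \<in> quiet n k c (tube h0 j0 w)" "(h0 + 1, i0, j0 + 1) \<in> K"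
    and i: "i \<in> quiet n k c (tube h0 j0 w)" "h0 < h" "h + 1 < h0 + w"
  shows "(h, i, j0 + 1) \<in> K"
proof -
  define T where "T = tube h0 j0 w"
  have lt: "i < n" if "i \<in> quiet n k c T" for i using that by (simp add: quiet_def)
  have free: "(h, i, j) \<in> cube n - c' ` {..<k}"
    if "i \<in> quiet n k c T" "h0 < h" "h + 1 < h0 + w" "j0 < j" "j + 1 < j0 + w" for h i j
    using quiet_section_free[OF turn, of i n h0 j0 w h j] that lt[OF that(1)] fit by (force simp: T_def)
  have square_connected: "(h', i, j') \<in> K"
    if K1: "(h1, i, j1) \<in> K" and ii: "i \<in> quiet n k c T"
      and b: "h0 < h1" "h1 + 1 < h0 + w" "j0 < j1" "j1 + 1 < j0 + w"
         "h0 < h'" "h' + 1 < h0 + w" "j0 < j'" "j' + 1 < j0 + w" for h1 h' i j1 j'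
  proof -
    have K2: "(h', i, j1) \<in> K"
    proof (rule cut_off_line[where f = "\<lambda>t. (t, i, j1)" and a = h1, OF symp_adj(2) K])
      show "(t, i, j1) \<in> cube n - c' ` {..<k}" if "min h1 h' \<le> t" "t \<le> max h1 h'" for t
        by (rule free[OF ii]) (use that b in \<open>auto simp: min_def max_def split: if_splits\<close>)
    qed (use K1 in auto)
    show ?thesis
    proof (rule cut_off_line[where f = "\<lambda>t. (h', i, t)" and a = j1, OF symp_adj(2) K])
      show "(h', i, t) \<in> cube n - c' ` {..<k}" if "min j1 j' \<le> t" "t \<le> max j1 j'" for t
        by (rule free[OF ii]) (use that b in \<open>auto simp: min_def max_def split: if_splits\<close>)
    qed (use K2 in auto)
  qed
  obtain hs js where s: "h0 < hs" "hs + 1 < h0 + w" "j0 < js" "js + 1 < j0 + w"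
    "\<And>i. (hs, i, js) \<notin> c' ` {..<k}"
  proof -
    define B where "B = {h0 + 1..<h0 + w - 1} \<times> {j0 + 1..<j0 + w - 1}"
    define X where "X = {(h, j) \<in> B. \<exists>i. (h, i, j) \<in> c' ` {..<k}}"
    have "card X \<le> card ((\<lambda>q. (fst (c' q), snd (snd (c' q)))) ` {q. q < k \<and> c q \<in> T})"
    proof (rule card_mono)
      show "X \<subseteq> (\<lambda>q. (fst (c' q), snd (snd (c' q)))) ` {q. q < k \<and> c q \<in> T}"
      proof
        fix x assume "x \<in> X"
        then obtain h j i where hj: "x = (h, j)" "(h, j) \<in> B" "(h, i, j) \<in> c' ` {..<k}"
          by (auto simp: X_def)
        then obtain q where "q < k" "c' q = (h, i, j)" by (metis imageE lessThan_iff)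
        then have x: "x = (h, j)" "(h, j) \<in> B" "q < k" "c' q = (h, i, j)" using hj by simp_all
        obtain a b d where abd: "c q = (a, b, d)" by (cases "c q")
        have "c q = (h, i, j) \<or> adj3 (c q) (h, i, j)" using turn x by (auto simp: cop_turn_def)
        then have "c q \<in> T"
          using x(2) by (auto simp: abd T_def B_def tube_def slab_def adj3_def adj2_def near_def)
        then show "x \<in> (\<lambda>q. (fst (c' q), snd (snd (c' q)))) ` {q. q < k \<and> c q \<in> T}"
          using x by (force simp: image_iff)
      qed
    qed auto
    also have "\<dots> \<le> cops_in k c T" unfolding cops_in_def by (rule card_image_le) auto
    also have "\<dots> < card B" using light by (simp add: B_def T_def)
    finally have "card X < card B" .
    moreover have "finite X" by (rule finite_subset[of _ B]) (auto simp: X_def B_def)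
    ultimately have "\<not> B \<subseteq> X" using card_mono[of X B] by (simp add: not_le[symmetric]) blast
    then show ?thesis using that by (force simp: X_def B_def)
  qed
  have 1: "(hs, i0, js) \<in> K"
    by (rule square_connected[OF i0(2)]) (use i0 s fit in \<open>auto simp: T_def\<close>)
  have 2: "(hs, i, js) \<in> K"
  proof (rule cut_off_line[where f = "\<lambda>t. (hs, t, js)" and a = i0, OF symp_adj(2) K])
    show "(hs, t, js) \<in> cube n - c' ` {..<k}" if "t \<le> max i0 i" for t
    proof -
      have "t < n" using that lt[of i0] lt[of i] i0 i by (simp add: T_def max_def split: if_splits)
      then show ?thesis using s(5)[of t] s(1-4) fit by simp
    qed
  qed (use 1 in auto)
  show ?thesis
    by (rule square_connected[OF 2]) (use i s fit in \<open>auto simp: T_def\<close>)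
qed

section \<open>The region of a robber in a light tube\<close>

text \<open>
  A free row through a quiet cross-section belongs to \<open>K\<close>, and each row that is not free uses up a cop of
  the layer.
\<close>

lemma core_area:
  assumes turn: "cop_turn k c c'" and light: "cops_in k c (tube h0 j0 w) < (w - 2) * (w - 2)"
    and fit: "h0 + w \<le> n" "j0 + w \<le> n" "3 \<le> w"
    and K: "cut_off adj3 (cube n) (c' ` {..<k}) K"
    and i0: "i0 \<in> quiet n k c (tube h0 j0 w)" "(h0 + 1, i0, j0 + 1) \<in> K"
    and h: "h0 < h" "h + 1 < h0 + w"
  shows "n * card (quiet n k c (tube h0 j0 w)) \<le> card (slice h K) + n * cops_in k c' (layer h)"
proof -
  define Q where "Q = quiet n k c (tube h0 j0 w)"
  define B where "B = {i. \<exists>j. (h, i, j) \<in> c' ` {..<k}}"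
  have finQ: "finite Q" by (simp add: Q_def quiet_def)
  have "B \<subseteq> (\<lambda>v. fst (snd v)) ` (c' ` {..<k})"
  proof
    fix i assume "i \<in> B"
    then obtain j where "(h, i, j) \<in> c' ` {..<k}" by (auto simp: B_def)
    from imageI[OF this, of "\<lambda>v. fst (snd v)"] show "i \<in> (\<lambda>v. fst (snd v)) ` (c' ` {..<k})" by simp
  qed
  then have finB: "finite B" by (rule finite_subset) auto
  have "card B \<le> cops_in k c' (layer h)"
    by (rule card_image_cops_le[where f = "\<lambda>v. fst (snd v)"]) (auto simp: B_def, metis fst_conv snd_conv)
  moreover have "card Q \<le> card (Q - B) + card B"
    using diff_card_le_card_Diff[OF finB, of Q] by simp
  ultimately have "card Q \<le> card (Q - B) + cops_in k c' (layer h)" by simp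
  then have "n * card Q \<le> n * (card (Q - B) + cops_in k c' (layer h))" by (rule mult_le_mono2)
  moreover have "n * card (Q - B) \<le> card (slice h K)"
  proof -
    have "(Q - B) \<times> {..<n} \<subseteq> slice h K"
    proof
      fix x assume "x \<in> (Q - B) \<times> {..<n}"
      then obtain i j where x: "x = (i, j)" and i: "i \<in> Q" "i \<notin> B" and j: "j \<in> {..<n}" by auto
      have 1: "(h, i, j0 + 1) \<in> K"
        using core_connected[OF turn light fit K i0 i(1)[unfolded Q_def] h] .
      have "(h, i, j) \<in> K"
      proof (rule cut_off_line[where f = "\<lambda>t. (h, i, t)" and a = "j0 + 1", OF symp_adj(2) K])
        show "(h, i, t) \<in> cube n - c' ` {..<k}" if "t \<le> max (j0 + 1) j" for t
          using that i j h fit by (auto simp: B_def Q_def quiet_def max_def split: if_splits)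
      qed (use 1 in auto)
      then show "x \<in> slice h K" by (simp add: x)
    qed
    then have "card ((Q - B) \<times> {..<n}) \<le> card (slice h K)"
      using finite_slice[of K n h] cut_off_subset[OF K] by (intro card_mono) auto
    then show ?thesis by (simp add: card_cartesian_product mult.commute)
  qed
  ultimately show ?thesis by (simp add: Q_def algebra_simps)
qed

lemma card_slice_cops: "card (slice h (c ` {..<k})) \<le> cops_in k c (layer h)"
  by (rule card_image_cops_le[where f = snd]) (auto, metis fst_conv snd_conv)

text \<open>
  A slab of \<open>w\<close> layers lies in the interior of a block of \<open>w + 2\<close> layers, which no cop of the slab can leave in
  one turn. Thus the sparsest slabs before and after the turn both bound the blocks after the turn.
\<close>

lemma window_after_turn:
  assumes "cop_turn k c c'" "h + (w + 2) \<le> n"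
  shows "max (slab_min n w k c) (slab_min n w k c') \<le> (\<Sum>i\<in>{h..<h + (w + 2)}. cops_in k c' (layer i))"
proof -
  have "slab_min n w k c \<le> cops_in k c (slab (h + 1) w)" using assms by (intro slab_min_le) simp
  also have "\<dots> \<le> cops_in k c' (slab h (w + 2))"
    by (rule cops_in_before_turn[OF assms(1)]) (auto simp: slab_def dest!: adj3_fst)
  finally have 1: "slab_min n w k c \<le> cops_in k c' (slab h (w + 2))" .
  have "slab_min n w k c' \<le> cops_in k c' (slab h w)" using assms by (intro slab_min_le) simp
  also have "\<dots> \<le> cops_in k c' (slab h (w + 2))" by (intro cops_in_mono) (auto simp: slab_def)
  finally show ?thesis using 1 by (simp add: cops_in_slab)
qed

text \<open>
  Suppose \<open>v\<close> is not in \<open>K\<close>. Some inner layer \<open>z1\<close> of the slab has at most \<open>\<mu>\<close> cops and by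
  \<open>core_area\<close> its large part is in \<open>K\<close>. The layer \<open>z2\<close> of the anchor also has at most \<open>\<mu>\<close> cops, but
  only its small part is in \<open>K\<close>. So \<open>two_thin_slices_cost\<close> applies to \<open>K\<close> or to its complement, depending
  on the order of \<open>z1\<close> and \<open>z2\<close>. The two terms in \<open>\<mu>\<close> are the densities of the sparsest slabs
  before the turn, for \<open>z1\<close>, and after the turn, for \<open>z2\<close>.
\<close>

lemma anchor_in_core:
  fixes \<mu> :: real
  assumes turn: "cop_turn k c c'" and cube: "c' ` {..<k} \<subseteq> cube n"
    and slab: "h0 \<le> n - w" "cops_in k c (slab h0 w) = slab_min n w k c"
    and light: "cops_in k c (tube h0 j0 w) < (w - 2) * (w - 2)"
    and fit: "w \<le> n" "j0 + w \<le> n" "3 \<le> w"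
    and K: "cut_off adj3 (cube n) (c' ` {..<k}) K"
    and i0: "i0 \<in> quiet n k c (tube h0 j0 w)" "(h0 + 1, i0, j0 + 1) \<in> K"
    and \<mu>: "\<mu> = max (real (slab_min n w k c) / (real w - 2)) (real (slab_min n w k c') / real w)"
      "\<mu> + 1 \<le> real n"
    and area: "\<mu>\<^sup>2 / 2 < real n * (real n - 3 * real (cops_in k c (tube h0 j0 w)) - \<mu>)"
    and cost: "real k < (real w - 2) / (real w + 2) * \<mu> * real n + (real n - \<mu>)\<^sup>2
      - 2 * (real w + 2) * \<mu> - real n - 1"
    and v: "anchor n w k c' v"
  shows "v \<in> K"
proof (rule ccontr)
  assume vK: "v \<notin> K"
  define S where "S = c' ` {..<k}"
  define p where "p h = cops_in k c' (layer h)" for h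
  define m where "m = slab_min n w k c"
  define m' where "m' = slab_min n w k c'"
  define L where "L = real (max m m')"
  have h0: "h0 + w \<le> n" using slab fit by simp
  have w2: "real w - 2 > 0" "real (w - 2) = real w - 2" using fit by auto
  have \<mu>m: "real m \<le> \<mu> * (real w - 2)" "real m' \<le> \<mu> * w"
    using \<mu>(1) w2 by (auto simp: m_def m'_def field_simps max_def not_le split: if_splits)
  have \<mu>0: "0 \<le> \<mu>" using \<mu>(1) by (simp add: le_max_iff_disj)
  have S: "S \<subseteq> cube n" "card (slice h S) \<le> p h" for h
    using cube card_slice_cops by (auto simp: S_def p_def)
  note K' = K[folded S_def]
  have "(\<Sum>h\<in>{h0 + 1..<h0 + w - 1}. p h) = cops_in k c' (slab (h0 + 1) (w - 2))"
  proof -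
    have "h0 + 1 + (w - 2) = h0 + w - 1" using fit by simp
    then show ?thesis by (simp only: cops_in_slab p_def)
  qed
  also have "\<dots> \<le> cops_in k c (slab h0 w)"
    by (rule cops_in_after_turn[OF turn]) (use fit in \<open>auto simp: slab_def dest!: adj3_fst\<close>)
  finally have "\<exists>h\<in>{h0 + 1..<h0 + w - 1}. card {h0 + 1..<h0 + w - 1} * p h \<le> m"
    using slab fit by (intro exists_small_summand) (auto simp: m_def)
  then obtain z1 where z1': "z1 \<in> {h0 + 1..<h0 + w - 1}" "card {h0 + 1..<h0 + w - 1} * p z1 \<le> m" by blast
  have "card {h0 + 1..<h0 + w - 1} = w - 2" by simp
  then have z1: "h0 < z1" "z1 + 1 < h0 + w" "(w - 2) * p z1 \<le> m" using z1' by auto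
  have z1n: "z1 < n" using z1 h0 by simp
  have "real ((w - 2) * p z1) \<le> real m" using z1(3) unfolding of_nat_le_iff .
  then have "real (p z1) \<le> real m / (real w - 2)" using w2 by (simp add: field_simps)
  then have p1: "p z1 \<le> \<mu>" using \<mu>(1) w2 by (simp add: m_def)
  have p1n: "p z1 < n" using p1 \<mu> by linarith
  have "real n * (n - 3 * real (cops_in k c (tube h0 j0 w)) - p z1) \<le> card (slice z1 K)"
  proof -
    have "real (n * card (quiet n k c (tube h0 j0 w))) \<le> real (card (slice z1 K) + n * p z1)"
      using core_area[OF turn light h0 fit(2,3) K i0 z1(1,2)] unfolding of_nat_le_iff p_def .
    moreover have "real n * (n - 3 * real (cops_in k c (tube h0 j0 w))) \<le> n * real (card (quiet n k c (tube h0 j0 w)))"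
      using card_quiet[of n k c "tube h0 j0 w"] by (intro mult_left_mono) auto
    ultimately show ?thesis by (simp add: algebra_simps)
  qed
  moreover have "real n * (n - 3 * real (cops_in k c (tube h0 j0 w)) - \<mu>)
     \<le> real n * (n - 3 * real (cops_in k c (tube h0 j0 w)) - p z1)"
    using p1 by (intro mult_left_mono) auto
  ultimately have a1: "\<mu>\<^sup>2 / 2 < card (slice z1 K)" using area by linarith
  have not_small: "\<not> 2 * card (slice z1 K) \<le> p z1 * (p z1 - 1)"
  proof
    assume "2 * card (slice z1 K) \<le> p z1 * (p z1 - 1)"
    also have "\<dots> \<le> p z1 * p z1" by simp
    finally have "real (2 * card (slice z1 K)) \<le> real (p z1 * p z1)" unfolding of_nat_le_iff .
    also have "\<dots> \<le> \<mu>\<^sup>2" using p1 by (simp add: power2_eq_square mult_mono)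
    finally show False using a1 by simp
  qed
  then have big1: "2 * card (square n - slice z1 S - slice z1 K) \<le> p z1 * (p z1 - 1)"
    using cut_off_dichotomy[OF cut_off_slice[OF K' z1n] slice_subset[OF S(1)] S(2) p1n] by blast
  obtain z2 i j where vz: "v = (z2, i, j)" "v \<in> cube n" "w * p z2 \<le> m'"
    and row: "\<And>q j. q < k \<Longrightarrow> c' q \<noteq> (z2, i, j)"
    using v by (auto simp: anchor_def p_def m'_def)
  have z2n: "z2 < n" using vz by simp
  have "real (w * p z2) \<le> real m'" using vz(3) unfolding of_nat_le_iff .
  then have "real (p z2) \<le> real m' / w" using fit by (simp add: field_simps)
  then have p2: "p z2 \<le> \<mu>" using \<mu>(1) by (simp add: m'_def)
  have p2n: "p z2 < n" using p2 \<mu> by linarith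
  have small2: "2 * card (slice z2 K) \<le> p z2 * (p z2 - 1)"
  proof (rule cut_off_small_of_row[OF cut_off_slice[OF K' z2n] slice_subset[OF S(1)] S(2) p2n])
    show "(i, j) \<notin> slice z2 S" for j
    proof
      assume "(i, j) \<in> slice z2 S"
      then have "(z2, i, j) \<in> c' ` {..<k}" by (simp add: S_def)
      then obtain q where "q < k" "c' q = (z2, i, j)" by (metis imageE lessThan_iff)
      then show False using row by blast
    qed
    show "i < n" "j < n" "(i, j) \<notin> slice z2 K" using vz vK by auto
  qed
  have "z1 \<noteq> z2" using small2 not_small by blast
  have win: "L \<le> real (\<Sum>i\<in>{h..<h + (w + 2)}. p i)" if "h + (w + 2) \<le> n" for h
    using window_after_turn[OF turn that] unfolding L_def m_def m'_def p_def of_nat_le_iff .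
  have L: "0 \<le> L" "L \<le> \<mu> * (real w + 2)" "\<mu> * (real w - 2) \<le> L"
  proof -
    have "\<mu> * (real w - 2) \<le> \<mu> * (real w + 2)" "\<mu> * w \<le> \<mu> * (real w + 2)" using \<mu>0 by (intro mult_left_mono; simp)+
    then show "L \<le> \<mu> * (real w + 2)" using \<mu>m by (simp add: L_def)
    have "\<mu> = real m / (real w - 2) \<or> \<mu> = real m' / w" using \<mu>(1) by (auto simp: m_def m'_def max_def)
    then show "\<mu> * (real w - 2) \<le> L"
    proof
      assume "\<mu> = real m / (real w - 2)"
      then show ?thesis using w2 by (simp add: L_def)
    next
      assume "\<mu> = real m' / w"
      then have "\<mu> * w = m'" using fit by simp
      moreover have "\<mu> * (real w - 2) \<le> \<mu> * w" using \<mu>0 w2 by (intro mult_left_mono) auto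
      ultimately show ?thesis by (simp add: L_def)
    qed
  qed (simp add: L_def)
  have L_le: "L \<le> \<mu> * real (w + 2)" using L(2) by (simp add: add.commute)
  have key: "L / real (w + 2) * real n - 2 * L + (real n - \<mu>)\<^sup>2 - real n - 1 \<le> real (\<Sum>h<n. p h)"
  proof (cases "z1 < z2")
    case True
    show ?thesis
      using two_thin_slices_cost[OF K' S(1) S(2) True z2n p1 p2 big1 small2 \<mu>0 \<mu>(2) _ L(1) L_le win]
      by simp
  next
    case False
    then have lt: "z2 < z1" using \<open>z1 \<noteq> z2\<close> by simp
    define K2 where "K2 = cube n - S - K"
    have cK2: "cut_off adj3 (cube n) S K2" unfolding K2_def by (rule cut_off_complement[OF symp_adj(2) K'])
    have sl: "slice h K2 = square n - slice h S - slice h K" if "h < n" for h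
      using that by (auto simp: K2_def)
    have sl': "square n - slice z2 S - slice z2 K2 = slice z2 K"
      using cut_off_subset[OF cut_off_slice[OF K' z2n]] unfolding sl[OF z2n] by blast
    show ?thesis
      using two_thin_slices_cost[OF cK2 S(1) S(2) lt z1n p2 p1 _ _ \<mu>0 \<mu>(2) _ L(1) L_le win] small2 big1
      unfolding sl' sl[OF z1n] by simp
  qed
  have "(\<Sum>h<n. p h) = cops_in k c' (slab 0 n)" by (simp add: cops_in_slab p_def lessThan_atLeast0)
  also have "\<dots> \<le> k" by (rule cops_in_le)
  finally have "real (\<Sum>h<n. p h) \<le> k" unfolding of_nat_le_iff .
  moreover have "(real w - 2) / (real w + 2) * \<mu> * n \<le> L / real (w + 2) * n"
  proof (rule mult_right_mono)
    have "(real w - 2) / (real w + 2) * \<mu> = \<mu> * (real w - 2) / (real w + 2)" by simp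
    also have "\<dots> \<le> L / (real w + 2)" using L(3) by (rule divide_right_mono) simp
    finally show "(real w - 2) / (real w + 2) * \<mu> \<le> L / real (w + 2)" by (simp add: add.commute)
  qed simp
  ultimately show False using key L(2) cost by (simp add: algebra_simps)
qed

section \<open>The strategy of the robber\<close>

lemma anchor_exists:
  assumes "0 < w" "w \<le> n" "slab_min n w k c < w * n"
  shows "\<exists>v. anchor n w k c v"
proof -
  obtain h0 where h0: "h0 \<le> n - w" "cops_in k c (slab h0 w) = slab_min n w k c"
    by (rule slab_min_attained)
  have "\<exists>h\<in>{h0..<h0 + w}. card {h0..<h0 + w} * cops_in k c (layer h) \<le> slab_min n w k c"
    using assms h0 by (intro exists_small_summand) (auto simp: cops_in_slab)
  then obtain h where h: "h \<in> {h0..<h0 + w}" "w * cops_in k c (layer h) \<le> slab_min n w k c" by auto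
  have "w * cops_in k c (layer h) < w * n" using h(2) assms(3) by linarith
  then have lt: "cops_in k c (layer h) < n" by simp
  have "\<not> {..<n} \<subseteq> {i. \<exists>q<k. \<exists>j. c q = (h, i, j)}"
  proof
    assume sub: "{..<n} \<subseteq> {i. \<exists>q<k. \<exists>j. c q = (h, i, j)}"
    have "card {..<n} \<le> cops_in k c (layer h)"
    proof (rule card_image_cops_le[where f = "\<lambda>v. fst (snd v)"])
      fix i assume "i \<in> {..<n}"
      then obtain q j where "q < k" "c q = (h, i, j)" using sub by blast
      then show "\<exists>q<k. c q \<in> layer h \<and> i = fst (snd (c q))" by auto
    qed
    then show False using lt by simp
  qed
  then obtain i where i: "i < n" "\<And>q j. q < k \<Longrightarrow> c q \<noteq> (h, i, j)" by blast
  have "anchor n w k c (h, i, 0)"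
    unfolding anchor_def using h h0 i assms by auto
  then show ?thesis ..
qed

text \<open>
  The factor 0.99999 absorbs the rounding in \<open>n div 1000\<close>.
\<close>

lemma le_of_div_times_le:
  assumes n: "10 ^ 10 \<le> n" and x: "real (n div 1000 * x) \<le> y"
  shows "real x \<le> y / (0.99999 * real n / 1000)"
proof -
  have "10 ^ 10 \<le> real n" using n by (metis of_nat_le_iff of_nat_numeral of_nat_power)
  moreover have "real n < real (1000 + n div 1000 * 1000)"
    unfolding of_nat_less_iff by (rule dividend_less_div_times) simp
  ultimately have "0.99999 * real n / 1000 \<le> real (n div 1000)" by simp
  then have "0.99999 * real n / 1000 * real x \<le> real (n div 1000) * real x"
    by (intro mult_right_mono) auto
  then show ?thesis using x \<open>10 ^ 10 \<le> real n\<close> by (simp add: field_simps)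
qed

lemma slab_min_density:
  assumes n: "10 ^ 10 \<le> n" and k: "real k \<le> 0.7172 * (real n)\<^sup>2"
  shows "real (slab_min n 1000 k c) \<le> 717.21 * real n"
proof -
  have "real (n div 1000 * slab_min n 1000 k c) \<le> real k" unfolding of_nat_le_iff by (rule slab_min_times_div_le)
  then have "real (n div 1000 * slab_min n 1000 k c) \<le> 0.7172 * (real n)\<^sup>2" using k by simp
  from le_of_div_times_le[OF n this] have "real (slab_min n 1000 k c) \<le> 0.7172 * (real n)\<^sup>2 / (0.99999 * real n / 1000)" .
  also have "\<dots> \<le> 717.21 * real n" using n by (simp add: power2_eq_square field_simps)
  finally show ?thesis .
qed

definition linked :: "nat \<Rightarrow> (nat \<times> nat \<times> nat) set \<Rightarrow> nat \<times> nat \<times> nat \<Rightarrow> nat \<times> nat \<times> nat \<Rightarrow> bool" where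
  "linked n S u v \<longleftrightarrow> (u, v) \<in> {(u, v). u \<in> cube n - S \<and> v \<in> cube n - S \<and> adj3 u v}\<^sup>*"

lemma linked_sym:
  assumes "linked n S u v"
  shows "linked n S v u"
proof -
  have "sym {(u, v). u \<in> cube n - S \<and> v \<in> cube n - S \<and> adj3 u v}"
    using sympD[OF symp_adj(2)] by (intro symI) simp
  from symD[OF sym_rtrancl[OF this]] assms show ?thesis unfolding linked_def .
qed

lemma linked_trans: "linked n S u v \<Longrightarrow> linked n S v x \<Longrightarrow> linked n S u x"
  unfolding linked_def by (rule rtrancl_trans)

lemma cut_off_linked:
  assumes "u \<in> cube n - S"
  shows "cut_off adj3 (cube n) S {v. linked n S u v}"
proof -
  have in_cube: "v \<in> cube n - S" if "linked n S u v" for v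
    using that unfolding linked_def by (rule rtranclE) (use assms in auto)
  show ?thesis
    unfolding cut_off_def
  proof (intro conjI subsetI ballI impI)
    fix v x assume v: "v \<in> {v. linked n S u v}" and x: "x \<in> cube n - S" and "adj3 v x"
    then have "(v, x) \<in> {(u, v). u \<in> cube n - S \<and> v \<in> cube n - S \<and> adj3 u v}"
      using in_cube by simp
    moreover have "(u, v) \<in> {(u, v). u \<in> cube n - S \<and> v \<in> cube n - S \<and> adj3 u v}\<^sup>*"
      using v by (simp add: linked_def)
    ultimately have "linked n S u x" unfolding linked_def by (rule rtrancl_into_rtrancl[rotated])
    then show "x \<in> {v. linked n S u v}" by simp
  qed (use in_cube in simp)
qed

text \<open>
  A vertex at which the robber can await the turn of the cops: wherever they go, he is not caught and
  remains linked to the anchors of the new placement.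
\<close>

definition safe :: "nat \<Rightarrow> nat \<Rightarrow> (nat \<Rightarrow> nat \<times> nat \<times> nat) \<Rightarrow> nat \<times> nat \<times> nat \<Rightarrow> bool" where
  "safe n k c r \<longleftrightarrow> r \<in> cube n \<and> (\<forall>c'. cop_turn k c c' \<longrightarrow> c' ` {..<k} \<subseteq> cube n \<longrightarrow>
     r \<notin> c' ` {..<k} \<and> (\<forall>v. anchor n 1000 k c' v \<longrightarrow> linked n (c' ` {..<k}) r v))"

text \<open>
  For slabs of 1000 layers, the densities are at most \<open>0.71866 n\<close>, which exceeds
  \<open>0.7172 n\<close> mainly by the factor \<open>1000 / 998\<close> for the loss of the boundary layers. At this density
  \<open>n (n - \<mu>)\<close> is still larger than \<open>\<mu>\<^sup>2 / 2\<close>, which fails from about \<open>0.732 n\<close> on. The cost of two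
  thin layers is \<open>(998 / 1002) \<mu> n + (n - \<mu>)\<^sup>2\<close> up to a linear term, and the minimum of this
  quadratic in \<open>\<mu>\<close> is more than \<open>0.747 n\<^sup>2\<close>. From \<open>n = 10 ^ 10\<close> on, the terms of lower order,
  which come from at most 717300 cops in the tube and from incomplete blocks, are negligible.
\<close>

lemma safe_vertex_exists:
  fixes k n :: nat
  assumes n: "10 ^ 10 \<le> n" and k: "real k \<le> 0.7172 * (real n)\<^sup>2"
  shows "\<exists>r. safe n k c r"
proof -
  define w :: nat where "w = 1000"
  define N where "N = real n"
  have N: "10 ^ 10 \<le> N" using n unfolding N_def by (metis of_nat_le_iff of_nat_numeral of_nat_power)
  have w: "w = 1000" "real w = 1000" by (simp_all add: w_def)
  have wn: "w \<le> n" using n by (simp add: w_def)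
  note div_bound = le_of_div_times_le[OF n, folded N_def]
  have m_le: "real (slab_min n w k c) \<le> 717.21 * N" for c
    using slab_min_density[OF n k] by (simp add: w_def N_def)
  obtain h0 where h0: "h0 \<le> n - w" "cops_in k c (slab h0 w) = slab_min n w k c"
    by (rule slab_min_attained)
  obtain j0 where j0: "j0 + w \<le> n" "n div w * cops_in k c (tube h0 j0 w) \<le> slab_min n w k c"
    using exists_light_tube[of w n k c h0] wn h0(2) by (auto simp: w)
  define t where "t = cops_in k c (tube h0 j0 w)"
  have "real (n div w * t) \<le> real (slab_min n w k c)" using j0(2) unfolding of_nat_le_iff t_def .
  then have "real (n div w * t) \<le> 717.21 * N" using m_le[of c] by linarith
  from div_bound[OF this[unfolded w]] have t: "real t \<le> 717300" using N by simp
  have light: "cops_in k c (tube h0 j0 w) < (w - 2) * (w - 2)"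
  proof -
    have "t \<le> 717300" using t by linarith
    then show ?thesis by (simp add: t_def w)
  qed
  have "card (quiet n k c (tube h0 j0 w)) \<noteq> 0"
  proof
    assume "card (quiet n k c (tube h0 j0 w)) = 0"
    then have "n \<le> 3 * t" using card_quiet[of n k c "tube h0 j0 w"] by (simp add: t_def)
    then have "N \<le> 3 * real t" by (simp add: N_def)
    then show False using t N by simp
  qed
  then obtain i0 where i0: "i0 \<in> quiet n k c (tube h0 j0 w)"
    by (metis card.empty equals0I)
  define r where "r = (h0 + 1, i0, j0 + 1)"
  have h0n: "h0 + w \<le> n" using h0 wn by simp
  have r_cube: "r \<in> cube n" using h0n j0 i0 by (simp add: r_def quiet_def w)
  have r_free: "r \<notin> c' ` {..<k}" if "cop_turn k c c'" for c'
    using quiet_section_free[OF that i0, of "h0 + 1" "j0 + 1"] by (force simp: r_def w)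
  have reach: "v \<in> K"
    if turn: "cop_turn k c c'" and sub: "c' ` {..<k} \<subseteq> cube n" and K: "cut_off adj3 (cube n) (c' ` {..<k}) K"
      and rK: "r \<in> K" and v: "anchor n w k c' v" for c' K v
  proof -
    define \<mu> where "\<mu> = max (real (slab_min n w k c) / (real w - 2)) (real (slab_min n w k c') / real w)"
    have \<mu>: "0 \<le> \<mu>" "\<mu> \<le> 0.71866 * N"
      using m_le[of c] m_le[of c'] N by (auto simp: \<mu>_def w le_max_iff_disj)
    show ?thesis
    proof (rule anchor_in_core[OF turn sub h0 light wn j0(1) _ K i0 rK[unfolded r_def] \<mu>_def _ _ _ v])
      show "\<mu> + 1 \<le> real n" using \<mu> N by (simp add: N_def)
      have "\<mu>\<^sup>2 \<le> (0.71866 * N)\<^sup>2" using \<mu> by (intro power_mono) auto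
      also have "\<dots> \<le> 0.5166 * (N * N)" by (simp add: power2_eq_square)
      finally have "\<mu>\<^sup>2 / 2 \<le> 0.2583 * (N * N)" by simp
      also have "\<dots> < N * (0.28 * N)" using N by simp
      also have "\<dots> \<le> N * (N - 3 * real t - \<mu>)" using t \<mu> N by (intro mult_left_mono) auto
      finally show "\<mu>\<^sup>2 / 2 < real n * (real n - 3 * real (cops_in k c (tube h0 j0 w)) - \<mu>)"
        by (simp add: N_def t_def)
      have "998 / 1002 * \<mu> * N + (N - \<mu>)\<^sup>2
          = 0.747 * N\<^sup>2 + ((\<mu> - 503 / 1002 * N)\<^sup>2 + (0.253 - (503 / 1002)\<^sup>2) * N\<^sup>2)"
        by (simp add: power2_eq_square algebra_simps)
      moreover have "0 \<le> (\<mu> - 503 / 1002 * N)\<^sup>2 + (0.253 - (503 / 1002)\<^sup>2) * N\<^sup>2"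
        by (intro add_nonneg_nonneg mult_nonneg_nonneg) (simp_all add: power2_eq_square)
      ultimately have q: "0.747 * N\<^sup>2 \<le> 998 / 1002 * \<mu> * N + (N - \<mu>)\<^sup>2" by linarith
      have "2004 * \<mu> + N + 1 \<le> 2000 * N" using \<mu> N by simp
      also have "\<dots> < 0.0298 * (N * N)" using N by simp
      finally have "2004 * \<mu> + N + 1 < 0.0298 * N\<^sup>2" by (simp add: power2_eq_square)
      then show "real k < (real w - 2) / (real w + 2) * \<mu> * real n + (real n - \<mu>)\<^sup>2 - 2 * (real w + 2) * \<mu> - real n - 1"
        using q k unfolding N_def[symmetric] by (simp add: w)
    qed (simp add: w)
  qed
  have "linked n (c' ` {..<k}) r v"
    if "cop_turn k c c'" "c' ` {..<k} \<subseteq> cube n" "anchor n w k c' v" for c' v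
  proof -
    have "cut_off adj3 (cube n) (c' ` {..<k}) {v. linked n (c' ` {..<k}) r v}"
      by (rule cut_off_linked) (use r_cube r_free[OF that(1)] in simp)
    moreover have "r \<in> {v. linked n (c' ` {..<k}) r v}" by (simp add: linked_def)
    ultimately have "v \<in> {v. linked n (c' ` {..<k}) r v}" by (rule reach[OF that(1,2) _ _ that(3)])
    then show ?thesis by simp
  qed
  then have "safe n k c r" using r_cube r_free unfolding safe_def w_def by blast
  then show ?thesis ..
qed

abbreviation grid3 :: "nat \<Rightarrow> (nat \<times> nat \<times> nat) pair_pre_digraph" where
  "grid3 n \<equiv> path_graph n \<box> path_graph n \<box> path_graph n"

lemma pverts_grid3: "pverts (grid3 n) = cube n"
  by (auto simp: cartesian_product_def path_graph_def cube_def square_def)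

lemma parcs_grid3: "(u, v) \<in> parcs (grid3 n) \<longleftrightarrow> u \<in> cube n \<and> v \<in> cube n \<and> adj3 u v"
  by (cases u; cases v) (auto simp: cartesian_product_def path_graph_def adj3_def adj2_def near_def)

lemma linked_walk:
  assumes "linked n S u v" "u \<in> cube n - S"
  shows "\<exists>p. vwalk p (with_proj (grid3 n)) \<and> hd p = u \<and> last p = v \<and> set p \<inter> S = {}"
  using assms(1) unfolding linked_def
proof (induction rule: rtrancl_induct)
  case base
  have "vwalk [u] (with_proj (grid3 n))" using assms(2) by (auto simp: pverts_grid3)
  then show ?case using assms(2) by (intro exI[of _ "[u]"]) auto
next
  case (step v x)
  then obtain p where p: "vwalk p (with_proj (grid3 n))" "hd p = u" "last p = v" "set p \<inter> S = {}" by blast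
  have ne: "p \<noteq> []" using p(1) by auto
  have "vwalk (p @ [x]) (with_proj (grid3 n))"
    using p step.hyps ne
    by (auto simp: vwalk_def pverts_grid3 set_vwalk_arcs_snoc parcs_grid3 intro!: vwalkI)
  then show ?case using p ne step.hyps by (intro exI[of _ "p @ [x]"]) auto
qed

lemma robber_move_linked:
  assumes "linked n S u v" "u \<in> cube n - S"
  shows "robber_move (grid3 n) S u v"
proof -
  obtain p where p: "vwalk p (with_proj (grid3 n))" "hd p = u" "last p = v" "set p \<inter> S = {}"
    using linked_walk[OF assms] by blast
  have "vpath (vwalk_to_vpath p) (with_proj (grid3 n))" using p(1) by (rule vwalk_to_vpath_vpath)
  moreover have "hd (vwalk_to_vpath p) = u" "last (vwalk_to_vpath p) = v"
    using p by (simp_all add: vwalk_to_vpath_hd vwalk_to_vpath_last)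
  moreover have "set (vwalk_to_vpath p) \<inter> S = {}" using p(4) vwalk_to_vpath_subset by fastforce
  ultimately show ?thesis unfolding robber_move_def by blast
qed

text \<open>
  The robber moves from safe vertex to safe vertex. The old one is linked to the anchors of the new placement by
  definition; so is the new one, because staying is a legal turn of the cops.
\<close>

lemma robber_wins:
  assumes n: "10 ^ 10 \<le> n" and k: "real k \<le> 0.7172 * (real n)\<^sup>2"
  shows "\<not> cops_win (grid3 n) k"
proof
  assume "cops_win (grid3 n) k"
  then obtain \<sigma> where \<sigma>: "cop_strategy (grid3 n) k \<sigma>"
    and win: "\<And>r. robber_play (grid3 n) \<sigma> r \<Longrightarrow> captured \<sigma> r"
    unfolding cops_win_def by blast
  have len: "length (\<sigma> h) = k" and sub: "set (\<sigma> h) \<subseteq> cube n" if "h \<in> lists (cube n)" for h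
    using \<sigma> that by (auto simp: cop_strategy_def pverts_grid3)
  have set_eq: "set (\<sigma> h) = (!) (\<sigma> h) ` {..<k}" if "h \<in> lists (cube n)" for h
    using len[OF that] by (auto simp: set_conv_nth)
  have turn: "cop_turn k ((!) (\<sigma> h)) ((!) (\<sigma> (h @ [x])))" if "h \<in> lists (cube n)" "x \<in> cube n" for h x
    using \<sigma> that unfolding cop_strategy_def cop_turn_def pverts_grid3 parcs_grid3 by blast
  define goal where "goal c = (SOME r. safe n k c r)" for c
  have goal: "safe n k c (goal c)" for c
    unfolding goal_def by (rule someI_ex) (rule safe_vertex_exists[OF n k])
  have goal_cube: "goal c \<in> cube n" for c using goal by (simp add: safe_def)
  have goal_free: "goal c \<notin> c' ` {..<k}" if "cop_turn k c c'" "c' ` {..<k} \<subseteq> cube n" for c c'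
    using goal that by (simp add: safe_def)
  have goal_linked: "linked n (c' ` {..<k}) (goal c) v"
    if "cop_turn k c c'" "c' ` {..<k} \<subseteq> cube n" "anchor n 1000 k c' v" for c c' v
    using goal[of c] that unfolding safe_def by blast
  define hist where "hist = rec_nat [] (\<lambda>_ h. h @ [goal ((!) (\<sigma> h))])"
  have hist: "hist 0 = []" "\<And>t. hist (Suc t) = hist t @ [goal ((!) (\<sigma> (hist t)))]"
    by (simp_all add: hist_def)
  define r where "r t = goal ((!) (\<sigma> (hist t)))" for t
  have hist_r: "map r [0..<t] = hist t" for t
    by (induction t) (simp_all add: hist r_def)
  have hist_in: "hist t \<in> lists (cube n)" for t
    by (induction t) (use goal_cube in \<open>auto simp: hist\<close>)
  define C where "C t = (!) (\<sigma> (hist t))" for t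
  have at: "set (cops_at \<sigma> r t) = C t ` {..<k}" for t
    using set_eq[OF hist_in] by (simp add: cops_at_def hist_r C_def)
  have C_sub: "C t ` {..<k} \<subseteq> cube n" for t
    using sub[OF hist_in] set_eq[OF hist_in] by (simp add: C_def)
  have C_turn: "cop_turn k (C t) (C (Suc t))" for t
    using turn[OF hist_in goal_cube] by (simp add: C_def hist)
  have stay: "cop_turn k (C t) (C t)" for t by (simp add: cop_turn_def)
  have free: "r t \<notin> C t ` {..<k}" "r t \<notin> C (Suc t) ` {..<k}" for t
    unfolding r_def C_def[symmetric] using goal_free stay C_turn C_sub by blast+
  have "robber_move (grid3 n) (C (Suc t) ` {..<k}) (r t) (r (Suc t))" for t
  proof -
    have "slab_min n 1000 k (C (Suc t)) < 1000 * n"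
    proof -
      have "real (slab_min n 1000 k (C (Suc t))) \<le> 717.21 * real n" by (rule slab_min_density[OF n k])
      also have "\<dots> < real (1000 * n)" using n by simp
      finally show ?thesis unfolding of_nat_less_iff .
    qed
    then obtain v where v: "anchor n 1000 k (C (Suc t)) v"
      using anchor_exists[of 1000 n k "C (Suc t)"] n by auto
    have "linked n (C (Suc t) ` {..<k}) (r t) v" "linked n (C (Suc t) ` {..<k}) (r (Suc t)) v"
      unfolding r_def C_def[symmetric] using goal_linked v stay C_turn C_sub by blast+
    then have "linked n (C (Suc t) ` {..<k}) (r t) (r (Suc t))" by (blast intro: linked_trans linked_sym)
    then show ?thesis
      by (rule robber_move_linked) (use free goal_cube in \<open>auto simp: r_def\<close>)
  qed
  then have "robber_play (grid3 n) \<sigma> r"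
    unfolding robber_play_def at using goal_cube by (simp add: r_def pverts_grid3)
  then have "captured \<sigma> r" by (rule win)
  then show False unfolding captured_def at using free by blast
qed

theorem theorem3p6:
  shows "\<exists>N. \<forall>n \<ge> N.
    real (c_inf (path_graph n \<box> path_graph n \<box> path_graph n)) > 0.7172 * (real n)\<^sup>2"
proof (intro exI[of _ "10 ^ 10"] allI impI)
  fix n :: nat assume n: "10 ^ 10 \<le> n"
  have "cops_win (grid3 n) (c_inf (grid3 n))"
    by (rule cops_win_c_inf) (simp add: pverts_grid3)
  then show "0.7172 * (real n)\<^sup>2 < real (c_inf (grid3 n))"
    using robber_wins[OF n, of "c_inf (grid3 n)"] by (meson not_le)
qed

end
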